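(* Let $K$ be a finite, connected, pure polygonal $2$-complex in $\mathbb{R}^2$, with a collection of hole polygons $\mathcal{C}^H$ and a singleton $\mathcal{C}^O$ consisting of the outside polygon, satisfying conditions (1)–(4) listed in the context. Let $\hat{K}$ be the Euler transformation of $K$. Then the graph $\hat G$ that is the $1$-skeleton of $\hat K$ is planar.
   Context: A polygonal complex ($2$-complex) $K$ is a collection of polygons in $\mathbb{R}^2$ (not necessarily convex) together with all their faces (edges and vertices), such that the nonempty intersection of any two polygons in $K$ is a face of both. It is pure if every vertex and every edge is a face of some polygon in $K$. Along with $K$ one is given a collection $\mathcal{C}^H$ of polygons capturing the holes, and a singleton $\mathcal{C}^O$ consisting of the polygon capturing the (unbounded) outside; vertices and edges in the intersection of a polygon in $K$ with a polygon in $\mathcal{C}^H$ or $\mathcal{C}^O$ are precisely the boundary cells of $K$. $|\cdot|$ denotes underlying space. Conditions: (1) $|K|\cup|\mathcal{C}^H|\cup|\mathcal{C}^O|=\mathbb{R}^2$; (2) polygons in $\mathcal{C}^H$ are pairwise disjoint and disjoint from the outside polygon; (3) any polygon in $K$ and any polygon in $\mathcal{C}^H$ intersect in at most one edge of both; (4) no two adjacent edges of a polygon in $K$ both lie on the outside polygon. Articulation (cut) vertices of $K$ are allowed; they are boundary vertices. Euler transformation $\hat K$ of $K$: every polygon $f\in K\cup\mathcal{C}^H\cup\mathcal{C}^O$ is duplicated to $\hat f$. If $f\in\mathcal{C}^H\cup\mathcal{C}^O$ then $\hat f=f$; if $f\in K$ then $\hat f$ is a mitered (inward, parallel-edge, as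 produced via the straight skeleton) offset of $f$, with offset small enough that there are no combinatorial changes (no edge shrinks to a point) and no topological changes ($f$ is not split). Each vertex $v$ (edge $e$) of $f$ has a copy $\hat v$ ($\hat e$) in $\hat f$. The polygons of $\hat K$ are: Class 1: $\hat f$ for each polygon $f\in K$. Class 2: for each edge $e=\{u,v\}\in K$, shared by $f\in K$ and $f'\in K\cup\mathcal{C}^H\cup\mathcal{C}^O$, the $4$-gon $\hat f_e$ with edges $\{\hat u,\hat v\},\{\hat v,\hat v'\},\{\hat u',\hat v'\},\{\hat u,\hat u'\}$, where $\hat u,\hat v$ are the copies of $u,v$ in $\hat f$ and $\hat u',\hat v'$ those in $\hat f'$; the edges $\{\hat u,\hat u'\},\{\hat v,\hat v'\}$ are new. Class 3: for each vertex $v\in K$ lying in polygons $f_1,\dots,f_p$ of $K\cup\mathcal{C}^H\cup\mathcal{C}^O$, the $p$-gon $\hat f_v$ with vertices $\hat v_k$ (the copy of $v$ in $\hat f_k$) and with an edge $\{\hat v_i,\hat v_j\}$ for every pair $f_i,f_j$ that intersect in an edge of $K$ containing $v$. The cells of $\hat K$ are these polygons with their edges and vertices; the $1$-skeleton is the graph of its vertices and edges. *)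

theory Defs
  imports "HOL-Analysis.Analysis"
begin

text \<open>The plane \<open>\<real>\<^sup>2\<close> is the type \<^typ>\<open>complex\<close>, on which norm, inner product and topology are
  the Euclidean ones. An edge is the set of its two endpoints; its segment is the convex hull.\<close>

section \<open>Closed polygonal chains and polygons\<close>

definition side :: "complex list \<Rightarrow> nat \<Rightarrow> complex set" where
  "side vs i = {vs ! i, vs ! (Suc i mod length vs)}"

definition sides :: "complex list \<Rightarrow> complex set set" where
  "sides vs = side vs ` {..<length vs}"

definition chain_image :: "complex list \<Rightarrow> complex set" where
  "chain_image vs = (\<Union>e\<in>sides vs. convex hull e)"

text \<open>Two sides may meet only in common endpoints, but the chain may pass through a vertex more than
  once. The outside polygon (or a hole) does so at a cut vertex of the complex.\<close>
definition noncrossing_chain :: "complex list \<Rightarrow> bool" where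
  "noncrossing_chain vs \<longleftrightarrow>
     3 \<le> length vs \<and>
     (\<forall>i<length vs. vs ! i \<noteq> vs ! (Suc i mod length vs)) \<and>
     (\<forall>i<length vs. \<forall>j<length vs. i \<noteq> j \<longrightarrow>
        convex hull (side vs i) \<inter> convex hull (side vs j) \<subseteq> side vs i \<inter> side vs j)"

definition simple_chain :: "complex list \<Rightarrow> bool" where
  "simple_chain vs \<longleftrightarrow> noncrossing_chain vs \<and> distinct vs"

text \<open>The region is part of the data because the boundary chain does not determine it: the same
  chain bounds a polygon and its unbounded exterior, and at cut vertices a hole need not be the
  inside of its chain. The starting point and orientation of the list are irrelevant.\<close>
record polygon =
  corners :: "complex list"
  region :: "complex set"

definition verts :: "polygon \<Rightarrow> complex set" where
  "verts f = set (corners f)"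

definition edges :: "polygon \<Rightarrow> complex set set" where
  "edges f = sides (corners f)"

definition faces :: "polygon \<Rightarrow> complex set set" where
  "faces f = (\<lambda>v. {v}) ` verts f \<union> (\<lambda>e. convex hull e) ` edges f"

definition simple_polygon :: "polygon \<Rightarrow> bool" where
  "simple_polygon f \<longleftrightarrow>
     simple_chain (corners f) \<and>
     region f = chain_image (corners f) \<union> inside (chain_image (corners f))"

definition polygonal_face :: "polygon \<Rightarrow> bool" where
  "polygonal_face f \<longleftrightarrow>
     noncrossing_chain (corners f) \<and>
     frontier (region f) = chain_image (corners f) \<and>
     closure (interior (region f)) = region f \<and>
     connected (interior (region f))"

definition hole_polygon :: "polygon \<Rightarrow> bool" where
  "hole_polygon f \<longleftrightarrow> polygonal_face f \<and> bounded (region f)"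

definition outside_polygon :: "polygon \<Rightarrow> bool" where
  "outside_polygon f \<longleftrightarrow> polygonal_face f \<and> bounded (- region f)"

section \<open>Polygonal complexes with holes and outside\<close>

definition underlying_space :: "polygon set \<Rightarrow> complex set" where
  "underlying_space K = (\<Union>f\<in>K. region f)"

text \<open>A complex is given by its set of polygons; its edges and vertices are those of the polygons,
  so that it is pure.\<close>
definition polygonal_complex :: "polygon set \<Rightarrow> bool" where
  "polygonal_complex K \<longleftrightarrow>
     (\<forall>f\<in>K. simple_polygon f) \<and>
     (\<forall>f\<in>K. \<forall>g\<in>K. f \<noteq> g \<longrightarrow>
        region f \<inter> region g = {} \<or> region f \<inter> region g \<in> faces f \<inter> faces g)"

definition complex_verts :: "polygon set \<Rightarrow> complex set" where
  "complex_verts K = (\<Union>f\<in>K. verts f)"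

definition complex_edges :: "polygon set \<Rightarrow> complex set set" where
  "complex_edges K = (\<Union>f\<in>K. edges f)"

text \<open>The third conjunct makes polygons of the complex meet the holes and the outside in (boundary)
  vertices and edges only; such an intersection need not be a single face.\<close>
definition holes_and_outside :: "polygon set \<Rightarrow> polygon set \<Rightarrow> polygon \<Rightarrow> bool" where
  "holes_and_outside K H Out \<longleftrightarrow>
     (\<forall>h\<in>H. hole_polygon h) \<and>
     outside_polygon Out \<and>
     (\<forall>f\<in>K. \<forall>g\<in>H \<union> {Out}. region f \<inter> region g = \<Union>(faces f \<inter> faces g)) \<and>
     underlying_space K \<union> underlying_space H \<union> underlying_space {Out} = UNIV \<and>
     (\<forall>g\<in>H \<union> {Out}. \<forall>h\<in>H. g \<noteq> h \<longrightarrow> region g \<inter> region h = {}) \<and>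
     (\<forall>f\<in>K. \<forall>h\<in>H. card (edges f \<inter> edges h) \<le> 1) \<and>
     (\<forall>f\<in>K. \<forall>e\<in>edges f. \<forall>e'\<in>edges f.
        e \<noteq> e' \<and> e \<inter> e' \<noteq> {} \<longrightarrow> \<not> (e \<in> edges Out \<and> e' \<in> edges Out))"

section \<open>Mitered offsets\<close>

text \<open>Unit normal of the side from \<open>a\<close> to \<open>b\<close>, on the side where the region \<open>R\<close> lies.\<close>
definition inward_normal :: "complex set \<Rightarrow> complex \<Rightarrow> complex \<Rightarrow> complex" where
  "inward_normal R a b =
     (let n = \<i> * sgn (b - a)
      in if \<forall>\<^sub>F s in at_right 0. midpoint a b + s *\<^sub>R n \<in> R then n else - n)"

text \<open>With \<open>n\<close>, \<open>n'\<close> the inward unit normals of the two sides at a corner, the velocity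
  \<open>w = (n + n') / (1 + n \<bullet> n')\<close> points along the angle bisector and satisfies
  \<open>w \<bullet> n = w \<bullet> n' = 1\<close>. At time \<open>s\<close> the moving corner is hence the intersection of the lines
  through the two sides, each shifted inward by \<open>s\<close>; the formula also covers straight corners.\<close>
definition miter_corner :: "polygon \<Rightarrow> real \<Rightarrow> nat \<Rightarrow> complex" where
  "miter_corner f s i =
     (let vs = corners f; m = length vs;
          u = vs ! ((i + m - 1) mod m); v = vs ! i; w = vs ! (Suc i mod m);
          n = inward_normal (region f) u v; n' = inward_normal (region f) v w
      in v + (s / (1 + n \<bullet> n')) *\<^sub>R (n + n'))"

definition offset_corners :: "polygon \<Rightarrow> real \<Rightarrow> complex list" where
  "offset_corners f s = map (miter_corner f s) [0..<length (corners f)]"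

text \<open>The whole wavefront up to time \<open>t\<close> stays a simple chain, so no side shrinks to a point and
  the polygon is not split, and it moves within the interior of the polygon.\<close>
definition admissible_offset :: "polygon \<Rightarrow> real \<Rightarrow> bool" where
  "admissible_offset f t \<longleftrightarrow>
     0 < t \<and>
     (\<forall>s\<in>{0..t}. simple_chain (offset_corners f s)) \<and>
     (\<forall>s\<in>{0<..t}. chain_image (offset_corners f s) \<subseteq> interior (region f))"

section \<open>The Euler transformation\<close>

text \<open>The copy of the vertex \<open>v\<close> in the duplicate of \<open>f\<close>: a corner of the offset of \<open>f\<close> by \<open>t f\<close>
  if \<open>f\<close> belongs to the complex, and \<open>v\<close> itself if \<open>f\<close> is a hole or the outside. The offsets of
  different polygons may differ.\<close>
definition vcopy :: "polygon set \<Rightarrow> (polygon \<Rightarrow> real) \<Rightarrow> polygon \<Rightarrow> complex \<Rightarrow> complex" where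
  "vcopy K t f v =
     (if f \<in> K then miter_corner f (t f) (THE i. i < length (corners f) \<and> corners f ! i = v)
      else v)"

text \<open>A polygon of the transformed complex is given by its set of vertices and its set of edges. At a
  cut vertex the edges of a vertex polygon do not form a single cycle.\<close>
type_synonym cell = "complex set \<times> complex set set"

definition class1 :: "polygon set \<Rightarrow> (polygon \<Rightarrow> real) \<Rightarrow> cell set" where
  "class1 K t = {(vcopy K t f ` verts f, (\<lambda>e. vcopy K t f ` e) ` edges f) | f. f \<in> K}"

definition edge_cell ::
  "polygon set \<Rightarrow> (polygon \<Rightarrow> real) \<Rightarrow> polygon \<Rightarrow> polygon \<Rightarrow> complex \<Rightarrow> complex \<Rightarrow> cell" where
  "edge_cell K t f f' u v =
     (let u1 = vcopy K t f u; v1 = vcopy K t f v; u2 = vcopy K t f' u; v2 = vcopy K t f' v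
      in ({u1, v1, u2, v2}, {{u1, v1}, {v1, v2}, {u2, v2}, {u1, u2}}))"

definition class2 ::
  "polygon set \<Rightarrow> polygon set \<Rightarrow> polygon \<Rightarrow> (polygon \<Rightarrow> real) \<Rightarrow> cell set" where
  "class2 K H Out t =
     {edge_cell K t f f' u v | f f' u v.
        f \<in> K \<and> f' \<in> K \<union> H \<union> {Out} \<and> f \<noteq> f' \<and> {u, v} \<in> edges f \<inter> edges f'}"

definition vertex_cell ::
  "polygon set \<Rightarrow> polygon set \<Rightarrow> polygon \<Rightarrow> (polygon \<Rightarrow> real) \<Rightarrow> complex \<Rightarrow> cell" where
  "vertex_cell K H Out t v =
     (let F = {f \<in> K \<union> H \<union> {Out}. v \<in> verts f}
      in ({vcopy K t f v | f. f \<in> F},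
          {{vcopy K t f v, vcopy K t g v} | f g.
             f \<in> F \<and> g \<in> F \<and> f \<noteq> g \<and> (\<exists>e\<in>complex_edges K. v \<in> e \<and> e \<in> edges f \<inter> edges g)}))"

definition class3 ::
  "polygon set \<Rightarrow> polygon set \<Rightarrow> polygon \<Rightarrow> (polygon \<Rightarrow> real) \<Rightarrow> cell set" where
  "class3 K H Out t = vertex_cell K H Out t ` complex_verts K"

definition euler_transformation ::
  "polygon set \<Rightarrow> polygon set \<Rightarrow> polygon \<Rightarrow> (polygon \<Rightarrow> real) \<Rightarrow> cell set" where
  "euler_transformation K H Out t = class1 K t \<union> class2 K H Out t \<union> class3 K H Out t"

section \<open>1-skeleton and planarity\<close>

definition skeleton_verts :: "cell set \<Rightarrow> complex set" where
  "skeleton_verts C = (\<Union>c\<in>C. fst c)"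

definition skeleton_edges :: "cell set \<Rightarrow> complex set set" where
  "skeleton_edges C = (\<Union>c\<in>C. snd c)"

text \<open>A (simple) graph is planar if it can be drawn in the plane: \<open>p\<close> places the vertices and
  \<open>\<gamma> e\<close> is the arc drawn for the edge \<open>e\<close>.\<close>
definition planar_graph :: "'a set \<Rightarrow> 'a set set \<Rightarrow> bool" where
  "planar_graph V E \<longleftrightarrow>
     (\<exists>(p :: 'a \<Rightarrow> complex) (\<gamma> :: 'a set \<Rightarrow> real \<Rightarrow> complex).
        inj_on p V \<and>
        (\<forall>e\<in>E. e \<subseteq> V \<and> arc (\<gamma> e) \<and> {pathstart (\<gamma> e), pathfinish (\<gamma> e)} = p ` e \<and>
               path_image (\<gamma> e) \<inter> p ` V = p ` e) \<and>
        (\<forall>e\<in>E. \<forall>e'\<in>E. e \<noteq> e' \<longrightarrow> path_image (\<gamma> e) \<inter> path_image (\<gamma> e') \<subseteq> p ` (e \<inter> e')))"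

end

theory Submission
  imports Defs
begin

text \<open>
  Planarity is combinatorial, so the copies may be redrawn with offsets \<open>s f\<close> much smaller than \<open>t f\<close>,
  such that everything drawn inside a polygon \<open>f\<close> stays in a thin collar of its boundary. Sides of the
  offset polygons and boundary edges are drawn straight. An edge between the copies of \<open>v\<close> in \<open>f\<close> and
  \<open>g\<close>, which share an edge \<open>e\<close> at \<open>v\<close>, is drawn as two segments (spokes) meeting in a point of \<open>e\<close> at
  a small distance from \<open>v\<close>; if \<open>g\<close> is a hole or the outside, a single spoke leads to \<open>v\<close> itself.
  The sides of \<open>f\<close> move at unit normal speed, so the wavefront sweeps out a one-sided neighbourhood of
  each edge and a spoke meets its side of the wavefront at its inner end only. By the Jordan curve
  theorem the wavefront avoids the boundary of \<open>f\<close>, so the drawings in different polygons can meet on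
  the 1-skeleton of \<open>K\<close> only. There, each edge has at most two polygons next to it, one per side.
\<close>

section \<open>Simple polygons\<close>

lemma chain_image_side: "chain_image vs = (\<Union>i<length vs. convex hull (side vs i))"
  by (simp add: chain_image_def sides_def)

text \<open>Induction on \<open>k\<close>: the next side starts at the corner \<open>vs ! k\<close>
  where the arc ends, and its far end is a new corner, so it meets the earlier sides there only and
  \<open>arc_join\<close> applies. The closing side is left out because of
  \<open>k < length vs\<close>.\<close>

lemma chain_partial_arc:
  assumes "simple_chain vs" "0 < k" "k < length vs"
  shows "\<exists>g. arc g \<and> pathstart g = vs ! 0 \<and> pathfinish g = vs ! k \<and>
           path_image g = (\<Union>i<k. convex hull (side vs i))"
  using assms(2,3)
proof (induction k)
  case (Suc k)
  have ne: "vs ! k \<noteq> vs ! Suc k"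
    using assms(1) Suc.prems by (auto simp: simple_chain_def nth_eq_iff_index_eq)
  have side_k: "side vs k = {vs ! k, vs ! Suc k}"
    using Suc.prems by (simp add: side_def)
  have line: "arc (linepath (vs ! k) (vs ! Suc k))" "path_image (linepath (vs ! k) (vs ! Suc k)) = convex hull (side vs k)"
    using ne by (simp_all add: side_k segment_convex_hull)
  show ?case
  proof (cases "k = 0")
    case True
    then show ?thesis using line by (intro exI[of _ "linepath (vs ! k) (vs ! Suc k)"]) auto
  next
    case False
    then obtain g where g: "arc g" "pathstart g = vs ! 0" "pathfinish g = vs ! k"
      "path_image g = (\<Union>i<k. convex hull (side vs i))"
      using Suc by auto
    have "convex hull (side vs i) \<inter> convex hull (side vs k) \<subseteq> {vs ! k}" if "i < k" for i
    proof -
      have "convex hull (side vs i) \<inter> convex hull (side vs k) \<subseteq> side vs i \<inter> side vs k"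
        using assms(1) Suc.prems that by (simp add: simple_chain_def noncrossing_chain_def)
      moreover have "vs ! Suc k \<notin> side vs i"
        using assms(1) Suc.prems that by (simp add: side_def simple_chain_def nth_eq_iff_index_eq)
      ultimately show ?thesis by (auto simp: side_k)
    qed
    then have "path_image g \<inter> path_image (linepath (vs ! k) (vs ! Suc k)) \<subseteq> {vs ! k}"
      unfolding line g by blast
    then have "arc (g +++ linepath (vs ! k) (vs ! Suc k))"
      using g line by (intro arc_join) auto
    moreover have "path_image (g +++ linepath (vs ! k) (vs ! Suc k)) = (\<Union>i<Suc k. convex hull (side vs i))"
      using g by (subst path_image_join) (auto simp: line lessThan_Suc simp del: path_image_linepath)
    ultimately show ?thesis
      by (intro exI[of _ "g +++ linepath (vs ! k) (vs ! Suc k)"] conjI)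
        (simp_all only: pathstart_join pathfinish_join pathfinish_linepath g)
  qed
qed simp

text \<open>The closing side meets the arc through the other sides in its two ends only, which
  closes the arc to a Jordan curve.\<close>

lemma chain_image_loop:
  assumes "simple_chain vs"
  shows "\<exists>g. simple_path g \<and> pathfinish g = pathstart g \<and> path_image g = chain_image vs"
proof -
  define m where "m = length vs - 1"
  have m: "length vs = Suc m" "0 < m" "m < length vs"
    using assms by (auto simp: m_def simple_chain_def noncrossing_chain_def)
  obtain g where g: "arc g" "pathstart g = vs ! 0" "pathfinish g = vs ! m"
      "path_image g = (\<Union>i<m. convex hull (side vs i))"
    using chain_partial_arc[OF assms m(2,3)] by blast
  have side_m: "side vs m = {vs ! m, vs ! 0}"
    by (simp add: side_def m)
  have ne: "vs ! m \<noteq> vs ! 0"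
    using assms m by (auto simp: simple_chain_def nth_eq_iff_index_eq)
  have line: "arc (linepath (vs ! m) (vs ! 0))" "path_image (linepath (vs ! m) (vs ! 0)) = convex hull (side vs m)"
    using ne by (simp_all add: side_m segment_convex_hull)
  have "convex hull (side vs i) \<inter> convex hull (side vs m) \<subseteq> {vs ! m, vs ! 0}" if "i < m" for i
  proof -
    have "convex hull (side vs i) \<inter> convex hull (side vs m) \<subseteq> side vs i \<inter> side vs m"
      using assms m that by (simp add: simple_chain_def noncrossing_chain_def)
    then show ?thesis by (auto simp: side_m)
  qed
  then have "path_image g \<inter> path_image (linepath (vs ! m) (vs ! 0)) \<subseteq> {vs ! 0, vs ! m}"
    unfolding line g by blast
  then have "simple_path (g +++ linepath (vs ! m) (vs ! 0))"
    using g line by (intro simple_path_join_loop) auto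
  moreover have "path_image (g +++ linepath (vs ! m) (vs ! 0)) = chain_image vs"
    using g by (subst path_image_join) (auto simp only: line m chain_image_side lessThan_Suc pathstart_linepath)
  ultimately show ?thesis
    by (intro exI[of _ "g +++ linepath (vs ! m) (vs ! 0)"] conjI)
      (simp_all only: pathstart_join pathfinish_join pathfinish_linepath g)
qed

text \<open>By the Jordan curve theorem every point of the chain is a limit of the outside. The
  outside misses the region, so no point of the chain is interior to it, whereas the inside is
  open.\<close>

lemma interior_simple_polygon:
  assumes "simple_polygon f"
  shows "interior (region f) = inside (chain_image (corners f))"
proof -
  let ?C = "chain_image (corners f)"
  obtain g where g: "simple_path g" "pathfinish g = pathstart g" "path_image g = ?C"
    using chain_image_loop assms simple_polygon_def by blast
  note J = Jordan_inside_outside[OF g(1,2), unfolded g(3)]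
  have reg: "region f = ?C \<union> inside ?C"
    using assms by (simp add: simple_polygon_def)
  have "?C \<inter> interior (region f) = {}"
  proof -
    have "region f \<inter> outside ?C = {}"
      using reg by (auto simp: outside_inside)
    then have "interior (region f) \<inter> closure (outside ?C) = {}"
      using interior_subset[of "region f"] by (subst open_Int_closure_eq_empty) auto
    then show ?thesis
      using J by (auto simp: frontier_def)
  qed
  moreover have "inside ?C \<subseteq> interior (region f)"
    using J reg by (intro interior_maximal) auto
  ultimately show ?thesis
    using reg interior_subset[of "region f"] by auto
qed

lemma inward_normal:
  assumes "a \<noteq> b"
  shows "norm (inward_normal R a b) = 1" "(b - a) \<bullet> inward_normal R a b = 0"
proof -
  have "norm (\<i> * sgn (b - a)) = 1"
    using assms by (simp add: norm_mult norm_sgn)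
  then show "norm (inward_normal R a b) = 1"
    by (simp add: inward_normal_def Let_def)
  have "(b - a) \<bullet> (\<i> * sgn (b - a)) = 0"
    by (simp add: sgn_div_norm inner_complex_def algebra_simps)
  then show "(b - a) \<bullet> inward_normal R a b = 0"
    by (simp add: inward_normal_def Let_def)
qed

section \<open>Wavefronts\<close>

definition corner_index :: "polygon \<Rightarrow> complex \<Rightarrow> nat" where
  "corner_index f v = (THE i. i < length (corners f) \<and> corners f ! i = v)"

text \<open>A mitered corner moves linearly in time, so its displacement after unit time is its
  velocity.\<close>

definition velocity :: "polygon \<Rightarrow> complex \<Rightarrow> complex" where
  "velocity f v = miter_corner f 1 (corner_index f v) - v"

text \<open>\<open>inward_normal\<close> takes the ends of a side in order; the choice of a position
  in the chain makes it a function of the unordered edge.\<close>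

definition normal :: "polygon \<Rightarrow> complex set \<Rightarrow> complex" where
  "normal f e =
     (let vs = corners f; i = SOME i. i < length vs \<and> e = side vs i
      in inward_normal (region f) (vs ! i) (vs ! (Suc i mod length vs)))"

definition front :: "polygon \<Rightarrow> real \<Rightarrow> complex \<Rightarrow> complex" where
  "front f s v = v + s *\<^sub>R velocity f v"

locale offset_polygon =
  fixes f :: polygon and T :: real
  assumes simple: "simple_polygon f" and admissible: "admissible_offset f T"
begin

abbreviation "C \<equiv> chain_image (corners f)"
abbreviation "m \<equiv> length (corners f)"

lemma simple_chain: "simple_chain (corners f)"
  using simple by (simp add: simple_polygon_def)

lemma distinct_corners: "distinct (corners f)"
  using simple_chain by (simp add: simple_chain_def)

lemma T_pos: "0 < T"
  using admissible by (simp add: admissible_offset_def)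

lemma corner_index_nth [simp]: "i < m \<Longrightarrow> corner_index f (corners f ! i) = i"
  unfolding corner_index_def using distinct_corners by (auto simp: nth_eq_iff_index_eq)

lemma miter_corner_eq: "i < m \<Longrightarrow> miter_corner f s i = front f s (corners f ! i)"
  by (simp add: front_def velocity_def miter_corner_def Let_def)

lemma offset_corners_eq: "offset_corners f s = map (front f s) (corners f)"
  by (rule nth_equalityI) (auto simp: offset_corners_def miter_corner_eq)

lemma side_map: "i < m \<Longrightarrow> side (map (front f s) (corners f)) i = front f s ` side (corners f) i"
proof -
  assume i: "i < m"
  then have "Suc i mod m < m" by (intro mod_less_divisor) auto
  with i show ?thesis by (simp add: side_def)
qed

lemma sides_offset: "sides (offset_corners f s) = image (front f s) ` edges f"
proof -
  have "sides (offset_corners f s) = side (map (front f s) (corners f)) ` {..<m}"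
    by (simp add: sides_def offset_corners_eq)
  also have "\<dots> = (\<lambda>i. front f s ` side (corners f) i) ` {..<m}"
    by (intro image_cong) (simp_all add: side_map)
  finally show ?thesis
    by (simp add: edges_def sides_def image_image)
qed

lemma finite_verts: "finite (verts f)" and finite_edges: "finite (edges f)"
  by (simp_all add: verts_def edges_def sides_def)

lemma edgeE:
  assumes "e \<in> edges f"
  obtains u v where "e = {u, v}" "u \<noteq> v" "u \<in> verts f" "v \<in> verts f"
proof -
  obtain i where i: "i < m" "e = side (corners f) i"
    using assms by (auto simp: edges_def sides_def)
  then have "corners f ! i \<noteq> corners f ! (Suc i mod m)"
    using simple_chain by (simp add: simple_chain_def noncrossing_chain_def)
  moreover have "Suc i mod m < m"
    using i by (intro mod_less_divisor) auto
  ultimately show ?thesis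
    using that i by (auto simp: side_def verts_def)
qed

lemma vert_in_edge:
  assumes "v \<in> verts f" obtains e where "e \<in> edges f" "v \<in> e"
proof -
  obtain i where "i < m" "v = corners f ! i"
    using assms by (auto simp: verts_def in_set_conv_nth)
  then show ?thesis
    by (intro that[of "side (corners f) i"]) (auto simp: edges_def sides_def side_def)
qed

lemma noncrossing:
  assumes "e \<in> edges f" "e' \<in> edges f" "e \<noteq> e'"
  shows "convex hull e \<inter> convex hull e' \<subseteq> e \<inter> e'"
proof -
  obtain i j where "i < m" "e = side (corners f) i" "j < m" "e' = side (corners f) j"
    using assms by (auto simp: edges_def sides_def)
  then show ?thesis
    using simple_chain assms(3) by (auto simp: simple_chain_def noncrossing_chain_def)
qed

lemma front_inj:
  assumes "0 \<le> s" "s \<le> T" shows "inj_on (front f s) (verts f)"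
proof -
  have "distinct (offset_corners f s)"
    using admissible assms by (auto simp: admissible_offset_def simple_chain_def)
  then show ?thesis
    by (simp add: offset_corners_eq distinct_map verts_def)
qed

lemma front_noncrossing:
  assumes "0 \<le> s" "s \<le> T" "e \<in> edges f" "e' \<in> edges f" "e \<noteq> e'"
  shows "convex hull (front f s ` e) \<inter> convex hull (front f s ` e') \<subseteq> front f s ` (e \<inter> e')"
proof -
  let ?c = "offset_corners f s"
  have c: "simple_chain ?c" and l: "length ?c = m"
    using admissible assms by (auto simp: admissible_offset_def offset_corners_def)
  obtain i j where "i < m" "e = side (corners f) i" "j < m" "e' = side (corners f) j"
    using assms by (auto simp: edges_def sides_def)
  then have ij: "i < m" "front f s ` e = side ?c i" "j < m" "front f s ` e' = side ?c j" "i \<noteq> j"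
    using assms by (auto simp: offset_corners_eq side_map)
  then have "convex hull (front f s ` e) \<inter> convex hull (front f s ` e') \<subseteq> front f s ` e \<inter> front f s ` e'"
    using c l by (auto simp: simple_chain_def noncrossing_chain_def)
  moreover have "e \<subseteq> verts f" "e' \<subseteq> verts f"
    using assms edgeE by (metis empty_subsetI insert_subset)+
  ultimately show ?thesis
    using inj_on_image_Int[OF front_inj] assms by metis
qed

lemma front_in_interior:
  assumes "0 < s" "s \<le> T" "e \<in> edges f"
  shows "convex hull (front f s ` e) \<subseteq> inside C"
proof -
  have "convex hull (front f s ` e) \<subseteq> chain_image (offset_corners f s)"
    using assms by (auto simp: chain_image_def sides_offset)
  also have "\<dots> \<subseteq> interior (region f)"
    using admissible assms by (simp add: admissible_offset_def)
  finally show ?thesis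
    by (simp add: interior_simple_polygon simple)
qed

lemma edge_subset_C: "e \<in> edges f \<Longrightarrow> convex hull e \<subseteq> C"
  by (auto simp: chain_image_def edges_def)

lemma front_vert_in_interior: "0 < s \<Longrightarrow> s \<le> T \<Longrightarrow> v \<in> verts f \<Longrightarrow> front f s v \<in> inside C"
  by (metis front_in_interior hull_inc image_eqI subsetD vert_in_edge)

lemma normal_ex:
  assumes "e \<in> edges f"
  obtains i where "i < m" "e = {corners f ! i, corners f ! (Suc i mod m)}"
    "corners f ! i \<noteq> corners f ! (Suc i mod m)"
    "normal f e = inward_normal (region f) (corners f ! i) (corners f ! (Suc i mod m))"
proof -
  define i where "i = (SOME i. i < m \<and> e = side (corners f) i)"
  have "\<exists>i. i < m \<and> e = side (corners f) i"
    using assms by (auto simp: edges_def sides_def)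
  then have i: "i < m \<and> e = side (corners f) i"
    unfolding i_def by (rule someI_ex)
  moreover have "corners f ! i \<noteq> corners f ! (Suc i mod m)"
    using i simple_chain by (simp add: simple_chain_def noncrossing_chain_def)
  moreover have "normal f e = inward_normal (region f) (corners f ! i) (corners f ! (Suc i mod m))"
    by (simp add: normal_def Let_def i_def)
  ultimately show ?thesis
    using that side_def by metis
qed

lemma norm_normal: "e \<in> edges f \<Longrightarrow> norm (normal f e) = 1"
  by (metis inward_normal(1) normal_ex)

lemma normal_perp:
  assumes "e \<in> edges f" "u \<in> e" "v \<in> e" shows "(v - u) \<bullet> normal f e = 0"
proof -
  obtain a b where "e = {a, b}" "(b - a) \<bullet> normal f e = 0"
    using assms(1) by (metis inward_normal(2) normal_ex)
  then show ?thesis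
    using assms by (auto simp: inner_diff_left)
qed

text \<open>With unit normals, \<open>(n + n') \<bullet> n\<close> equals
  \<open>1 + n \<bullet> n'\<close>, so the miter formula gives 1 once its denominator is known to
  be nonzero.\<close>

lemma corner_velocity:
  assumes i: "i < m"
  defines "n \<equiv> inward_normal (region f) (corners f ! ((i + m - 1) mod m)) (corners f ! i)"
    and "n' \<equiv> inward_normal (region f) (corners f ! i) (corners f ! (Suc i mod m))"
  assumes n: "norm n = 1" "norm n' = 1"
  shows "velocity f (corners f ! i) \<bullet> n = 1" "velocity f (corners f ! i) \<bullet> n' = 1"
proof -
  let ?v = "corners f ! i"
  have vel: "velocity f ?v = (1 / (1 + n \<bullet> n')) *\<^sub>R (n + n')"
    unfolding velocity_def corner_index_nth[OF i] miter_corner_def Let_def n_def n'_def by simp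
  \<comment> \<open>A zero denominator would give velocity 0, as division by zero yields 0. The
    corner would then rest on the boundary, while an admissible offset moves it into the
    interior.\<close>
  have "velocity f ?v \<noteq> 0"
  proof
    assume "velocity f ?v = 0"
    then have "?v \<in> inside C"
      using front_vert_in_interior[of T ?v] T_pos i by (simp add: front_def verts_def)
    moreover have "?v \<in> C"
      using i by (auto simp: chain_image_side side_def intro: hull_inc)
    ultimately show False
      using inside_no_overlap by blast
  qed
  then have "1 + n \<bullet> n' \<noteq> 0"
    using vel by auto
  moreover have "n \<bullet> n = 1" "n' \<bullet> n' = 1"
    using n by (simp_all add: dot_square_norm)
  ultimately show "velocity f ?v \<bullet> n = 1" "velocity f ?v \<bullet> n' = 1"
    by (simp_all add: vel inner_add_left inner_commute[of n' n] add.commute)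
qed

lemma velocity_normal:
  assumes e: "e \<in> edges f" and v: "v \<in> e"
  shows "velocity f v \<bullet> normal f e = 1"
proof -
  obtain i where i: "i < m" "e = {corners f ! i, corners f ! (Suc i mod m)}"
    "normal f e = inward_normal (region f) (corners f ! i) (corners f ! (Suc i mod m))"
    using normal_ex[OF e] by metis
  have m: "3 \<le> m" and ne: "\<And>j. j < m \<Longrightarrow> corners f ! j \<noteq> corners f ! (Suc j mod m)"
    using simple_chain by (auto simp: simple_chain_def noncrossing_chain_def)
  have nrm: "norm (inward_normal (region f) (corners f ! j) (corners f ! (Suc j mod m))) = 1" if "j < m" for j
    using ne[OF that] by (rule inward_normal)
  \<comment> \<open>\<open>j + m - 1\<close> is the cyclic predecessor of \<open>j\<close>; adding
    \<open>m\<close> avoids truncated subtraction at 0. If \<open>v\<close> is the first end of the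
    side, \<open>e\<close> is the side that leaves \<open>v\<close>.\<close>
  have prev: "Suc ((j + m - 1) mod m) mod m = j" if "j < m" for j
  proof (cases j)
    case 0
    moreover have "Suc (m - 1) = m" using m by simp
    ultimately show ?thesis by simp
  next
    case (Suc k)
    then have "(j + m - 1) mod m = k" using that by simp
    then show ?thesis using Suc that by simp
  qed
  have lt: "(j + m - 1) mod m < m" "Suc j mod m < m" for j
    by (rule mod_less_divisor, use m in linarith)+
  \<comment> \<open>If \<open>v\<close> is the second end, \<open>e\<close> is the side that arrives
    at \<open>v\<close>, and the predecessor of its index is \<open>i\<close> again.\<close>
  have prev': "(Suc i mod m + m - 1) mod m = i"
  proof (cases "Suc i = m")
    case True
    then have "Suc i mod m + m - 1 = i" by simp
    then show ?thesis using i(1) by simp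
  next
    case False
    then have "Suc i mod m + m - 1 = i + m" using i(1) by simp
    then show ?thesis using i(1) by simp
  qed
  show ?thesis
  proof (cases "v = corners f ! i")
    case True
    then show ?thesis
      using corner_velocity(2)[OF i(1)] nrm[OF i(1)] nrm[OF lt(1), of i]
      unfolding prev[OF i(1)] i(3) by metis
  next
    case False
    then have "v = corners f ! (Suc i mod m)" using i v by auto
    then show ?thesis
      using corner_velocity(1)[OF lt(2), of i] nrm[OF i(1)] nrm[OF lt(2), of i]
      unfolding prev' i(3) by metis
  qed
qed

end

section \<open>Spokes\<close>

text \<open>Smallness conditions are stated along \<open>at_right 0\<close>, so that finitely many
  of them can be collected before a witness is taken.\<close>

lemma eventually_mult_less: "0 < c \<Longrightarrow> \<forall>\<^sub>F r in at_right (0::real). r * b < c"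
  by (rule order_tendstoD(2)[where y = 0]) (auto intro!: tendsto_eq_intros)

text \<open>The plane has only one direction orthogonal to \<open>n\<close>: eliminating
  \<open>n\<close> from the two equations makes the determinant of \<open>a\<close> and
  \<open>b\<close> vanish.\<close>

lemma orthogonal_parallel:
  fixes a b n :: complex
  assumes "a \<bullet> n = 0" "b \<bullet> n = 0" "a \<noteq> 0" "n \<noteq> 0"
  shows "\<exists>r. b = r *\<^sub>R a"
proof -
  obtain a1 a2 b1 b2 p q where [simp]: "a = Complex a1 a2" "b = Complex b1 b2" "n = Complex p q"
    by (metis complex.exhaust)
  have *: "a1 * p + a2 * q = 0" "b1 * p + b2 * q = 0" "p \<noteq> 0 \<or> q \<noteq> 0" "a1 \<noteq> 0 \<or> a2 \<noteq> 0"
    using assms by (auto simp: inner_complex_def complex_eq_iff)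
  have "p * (a1 * b2 - a2 * b1) = 0" "q * (a1 * b2 - a2 * b1) = 0"
    using *(1,2) by algebra+
  then have det: "a1 * b2 = a2 * b1"
    using *(3) by auto
  show ?thesis
  proof (cases "a1 = 0")
    case True
    then show ?thesis
      using * det by (intro exI[of _ "b2 / a2"]) (auto simp: complex_eq_iff)
  next
    case False
    then show ?thesis
      using det by (intro exI[of _ "b1 / a1"]) (auto simp: complex_eq_iff field_simps)
  qed
qed

text \<open>For \<open>e = {u, v}\<close> the vector \<open>\<Sum>e - 2 * u\<close> is \<open>v - u\<close>.\<close>
definition cut :: "real \<Rightarrow> complex set \<Rightarrow> complex \<Rightarrow> complex" where
  "cut k e u = u + k *\<^sub>R (\<Sum>e - 2 * u)"

lemma cut_doubleton: "u \<noteq> v \<Longrightarrow> cut k {u, v} u = u + k *\<^sub>R (v - u)"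
  by (simp add: cut_def algebra_simps)

text \<open>The possible outer ends of the spokes of \<open>u\<close>. The vertex itself serves for
  a hole or the outside, a cut point for a neighbouring polygon of the complex.\<close>

definition targets :: "real \<Rightarrow> polygon \<Rightarrow> complex \<Rightarrow> complex set" where
  "targets k f u = insert u {cut k e u | e. e \<in> edges f \<and> u \<in> e}"

text \<open>Two spokes of the same vertex are kept apart by the first clause, because their outer
  ends lie on the boundary; see \<open>spokes_at_vert\<close>.\<close>

definition clear_spokes :: "polygon \<Rightarrow> real \<Rightarrow> real \<Rightarrow> bool" where
  "clear_spokes f s k \<longleftrightarrow>
     (\<forall>u\<in>verts f. \<forall>z\<in>targets k f u.
        closed_segment (front f s u) z \<subseteq> insert z (inside (chain_image (corners f))) \<and>
        (\<forall>e\<in>edges f. closed_segment (front f s u) z \<inter> convex hull (front f s ` e)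
            \<subseteq> {front f s u} \<inter> front f s ` e) \<and>
        (\<forall>u'\<in>verts f. \<forall>z'\<in>targets k f u'. u \<noteq> u' \<longrightarrow>
          closed_segment (front f s u) z \<inter> closed_segment (front f s u') z' = {}))"

context offset_polygon
begin

section \<open>Edges moving with the wavefront\<close>

lemma edge_otherE:
  assumes "e \<in> edges f" "u \<in> e"
  obtains v where "e = {u, v}" "u \<noteq> v" "u \<in> verts f" "v \<in> verts f"
proof -
  obtain a b where "e = {a, b}" "a \<noteq> b" "a \<in> verts f" "b \<in> verts f"
    using edgeE assms(1) by metis
  then show ?thesis
    using that[of a] that[of b] assms(2) by (cases "u = a") auto
qed

lemma vert_in_hull:
  assumes "v \<in> verts f" "e \<in> edges f" "v \<in> convex hull e"
  shows "v \<in> e"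
proof -
  obtain e' where "e' \<in> edges f" "v \<in> e'" using vert_in_edge assms(1) by metis
  then show ?thesis using noncrossing[of e e'] assms hull_inc[of v e'] by blast
qed

text \<open>Both ends advance at unit normal speed, so their relative velocity is orthogonal to the
  normal. Hence the moving edge stays parallel to itself, and at time \<open>s\<close> its direction
  vector is multiplied by \<open>1 + s * r\<close>.\<close>

lemma velocity_diff:
  assumes "{u, v} \<in> edges f" "u \<noteq> v"
  shows "\<exists>r. velocity f v - velocity f u = r *\<^sub>R (v - u)"
proof (rule orthogonal_parallel)
  show "(v - u) \<bullet> normal f {u, v} = 0"
    using assms by (intro normal_perp) auto
  show "(velocity f v - velocity f u) \<bullet> normal f {u, v} = 0"
    using assms by (simp add: inner_diff_left velocity_normal)
  show "normal f {u, v} \<noteq> 0"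
    using norm_normal[OF assms(1)] by auto
qed (use assms in simp)

text \<open>Time \<open>y\<close> and position \<open>k\<close> along the edge are coordinates on
  the strip that the moving edge sweeps out. At time \<open>y\<close> the edge covers the positions
  from 0 to \<open>1 + y * r\<close>, so the point lies on the wavefront of that time.\<close>

lemma strip_in_inside:
  assumes "{u, v} \<in> edges f" "velocity f v - velocity f u = r *\<^sub>R (v - u)"
    and "0 < y" "y \<le> T" "0 \<le> k" "k \<le> 1 + y * r" "0 < 1 + y * r"
  shows "u + y *\<^sub>R velocity f u + k *\<^sub>R (v - u) \<in> inside C"
proof -
  define l where "l = k / (1 + y * r)"
  have l: "0 \<le> l" "l \<le> 1" "k = l * (1 + y * r)"
    using assms by (auto simp: l_def)
  have vel: "velocity f v = velocity f u + r *\<^sub>R (v - u)"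
    using assms(2) by (simp add: algebra_simps)
  have "u + y *\<^sub>R velocity f u + k *\<^sub>R (v - u) = (1 - l) *\<^sub>R front f y u + l *\<^sub>R front f y v"
    unfolding front_def vel l(3) by (simp add: algebra_simps)
  also have "\<dots> \<in> closed_segment (front f y u) (front f y v)"
    using l by (auto simp: in_segment)
  also have "\<dots> \<subseteq> inside C"
    using front_in_interior[OF assms(3,4,1)] by (simp add: segment_convex_hull)
  finally show ?thesis .
qed

text \<open>The height over the edge is an affine function, and it equals \<open>s\<close> at both
  moved ends.\<close>

lemma front_height:
  assumes "e \<in> edges f" "u \<in> e" "x \<in> convex hull (front f s ` e)"
  shows "(x - u) \<bullet> normal f e = s"
proof -
  obtain v where e: "e = {u, v}" using edge_otherE assms by metis
  have "x \<in> closed_segment (front f s u) (front f s v)"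
    using assms(3) by (simp add: e segment_convex_hull)
  then obtain l where x: "x = (1 - l) *\<^sub>R front f s u + l *\<^sub>R front f s v"
    by (auto simp: in_segment)
  have "x - u = s *\<^sub>R ((1 - l) *\<^sub>R velocity f u + l *\<^sub>R velocity f v) + l *\<^sub>R (v - u)"
    by (simp add: x front_def algebra_simps)
  moreover have "(v - u) \<bullet> normal f e = 0" "velocity f u \<bullet> normal f e = 1" "velocity f v \<bullet> normal f e = 1"
    using assms(1) e by (auto intro: normal_perp velocity_normal)
  ultimately show ?thesis
    by (simp add: inner_add_left)
qed

text \<open>Points near the midpoint with positive height lie in the strip swept out by the edge. It
  is thus the admissibility of the offset that shows that the normal points into the
  polygon.\<close>

lemma half_disc:
  assumes e: "{u, v} \<in> edges f" "u \<noteq> v"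
  shows "\<forall>\<^sub>F z in nhds (midpoint u v). 0 < (z - u) \<bullet> normal f {u, v} \<longrightarrow> z \<in> inside C"
proof -
  let ?N = "normal f {u, v}" and ?m = "midpoint u v"
  define y where "y z = (z - u) \<bullet> ?N" for z
  \<comment> \<open>With the height \<open>y z\<close>, this is the second coordinate of
    \<open>z\<close> with respect to the oblique basis \<open>velocity f u\<close>,
    \<open>v - u\<close>.\<close>
  define k where "k z = (z - u - y z *\<^sub>R velocity f u) \<bullet> (v - u) / ((v - u) \<bullet> (v - u))" for z
  obtain r where r: "velocity f v - velocity f u = r *\<^sub>R (v - u)"
    using velocity_diff[OF e] by blast
  have perp: "(v - u) \<bullet> ?N = 0" and vel: "velocity f u \<bullet> ?N = 1"
    using e by (auto intro: normal_perp velocity_normal)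
  have mid: "?m - u = (1/2) *\<^sub>R (v - u)"
    by (simp add: midpoint_def complex_eq_iff field_simps)
  then have y_m: "y ?m = 0"
    by (simp add: y_def perp)
  have k_m: "k ?m = 1/2"
    using e unfolding k_def y_m mid by simp
  \<comment> \<open>These bounds give \<open>k z < 3/4 < 1 + y z * r\<close>, as the strip
    requires.\<close>
  let ?U = "{z. 1/4 < k z} \<inter> {z. k z < 3/4} \<inter> {z. y z < T} \<inter> {z. \<bar>y z * r\<bar> < 1/4}"
  have "open ?U"
    unfolding k_def y_def
    by (intro open_Int open_Collect_less continuous_intros) (use e in auto)
  moreover have "?m \<in> ?U"
    using y_m k_m T_pos by simp
  ultimately have "\<forall>\<^sub>F z in nhds ?m. z \<in> ?U"
    by (rule eventually_nhds_in_open)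
  then show ?thesis
  proof (rule eventually_mono, intro impI)
    fix z assume z: "z \<in> ?U" and "0 < (z - u) \<bullet> ?N"
    then have pos: "0 < y z" by (simp add: y_def)
    have "(z - u - y z *\<^sub>R velocity f u) \<bullet> ?N = 0"
      by (simp add: inner_diff_left vel y_def)
    moreover have "?N \<noteq> 0" using norm_normal[OF e(1)] by auto
    ultimately obtain c where c: "z - u - y z *\<^sub>R velocity f u = c *\<^sub>R (v - u)"
      using orthogonal_parallel[OF perp] e by force
    then have "k z = c" using e by (simp add: k_def)
    then have "z = u + y z *\<^sub>R velocity f u + k z *\<^sub>R (v - u)"
      using c by (simp add: algebra_simps)
    also have "\<dots> \<in> inside C"
      using z pos by (intro strip_in_inside[OF e(1) r]) auto
    finally show "z \<in> inside C" .
  qed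
qed

text \<open>Three scales are chosen in turn: a radius \<open>r\<close> that separates the vertices,
  then the offset \<open>s\<close>, then the cut ratio \<open>k\<close>. All small \<open>k\<close>
  are allowed in the conclusion because one \<open>k\<close> has to serve all polygons
  later.\<close>

lemma spokes:
  obtains s where "0 < s" "s \<le> T"
    "\<forall>\<^sub>F k in at_right 0. clear_spokes f s k"
proof -
  \<comment> \<open>The disc of radius \<open>2 * r\<close> about a vertex shall avoid the other
    vertices and all edges that do not end there.\<close>
  have "\<forall>\<^sub>F r in at_right (0::real). \<forall>u\<in>verts f. \<forall>e\<in>edges f. u \<notin> e \<longrightarrow> r * 2 < infdist u (convex hull e)"
  proof (intro eventually_ball_finite ballI finite_verts finite_edges)
    fix u e assume ue: "u \<in> verts f" "e \<in> edges f"
    show "\<forall>\<^sub>F r in at_right (0::real). u \<notin> e \<longrightarrow> r * 2 < infdist u (convex hull e)"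
    proof (cases "u \<in> e")
      case False
      obtain a b where ab: "e = {a, b}" using edgeE ue by metis
      then have "closed (convex hull e)" "convex hull e \<noteq> {}"
        by (auto intro!: compact_imp_closed finite_imp_compact_convex_hull)
      then have "0 < infdist u (convex hull e)"
        using vert_in_hull ue False by (metis infdist_pos_not_in_closed)
      then show ?thesis
        using eventually_mult_less by simp
    qed auto
  qed
  moreover have "\<forall>\<^sub>F r in at_right (0::real). \<forall>u\<in>verts f. \<forall>v\<in>verts f. u \<noteq> v \<longrightarrow> r * 2 < dist u v"
  proof (intro eventually_ball_finite ballI finite_verts)
    fix u v
    show "\<forall>\<^sub>F r in at_right (0::real). u \<noteq> v \<longrightarrow> r * 2 < dist u v"
      using eventually_mult_less[of "dist u v"] by (cases "u = v") auto
  qed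
  ultimately have "\<forall>\<^sub>F r in at_right (0::real). 
      (\<forall>u\<in>verts f. \<forall>e\<in>edges f. u \<notin> e \<longrightarrow> r * 2 < infdist u (convex hull e)) \<and>
      (\<forall>u\<in>verts f. \<forall>v\<in>verts f. u \<noteq> v \<longrightarrow> r * 2 < dist u v) \<and> 0 < r"
    using eventually_at_right_less by (intro eventually_conj)
  from eventually_happens'[OF trivial_limit_at_right_real this] obtain r where
      "\<forall>u\<in>verts f. \<forall>e\<in>edges f. u \<notin> e \<longrightarrow> r * 2 < infdist u (convex hull e)"
      "\<forall>u\<in>verts f. \<forall>v\<in>verts f. u \<noteq> v \<longrightarrow> r * 2 < dist u v" "0 < r"
    by blast
  note r = this(1,2)[rule_format] this(3)
  \<comment> \<open>The offset shall keep each corner within \<open>r\<close> of its vertex. By the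
    second condition below, every edge keeps more than half its length.\<close>
  have "\<forall>\<^sub>F s in at_right (0::real). \<forall>u\<in>verts f. s * norm (velocity f u) < r"
    by (intro eventually_ball_finite ballI finite_verts eventually_mult_less r)
  moreover have "\<forall>\<^sub>F s in at_right (0::real). \<forall>u\<in>verts f. \<forall>v\<in>verts f. u \<noteq> v \<longrightarrow>
      s * norm (velocity f v - velocity f u) < norm (v - u) / 2"
  proof (intro eventually_ball_finite ballI finite_verts)
    fix u v
    show "\<forall>\<^sub>F s in at_right (0::real). u \<noteq> v \<longrightarrow> s * norm (velocity f v - velocity f u) < norm (v - u) / 2"
      using eventually_mult_less[of "norm (v - u) / 2"] by (cases "u = v") auto
  qed
  moreover have "\<forall>\<^sub>F s in at_right (0::real). s * 1 < T"
    using T_pos by (rule eventually_mult_less)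
  ultimately have "\<forall>\<^sub>F s in at_right (0::real). (\<forall>u\<in>verts f. s * norm (velocity f u) < r) \<and>
      (\<forall>u\<in>verts f. \<forall>v\<in>verts f. u \<noteq> v \<longrightarrow> s * norm (velocity f v - velocity f u) < norm (v - u) / 2)
      \<and> s * 1 < T \<and> 0 < s"
    using eventually_at_right_less by (intro eventually_conj)
  from eventually_happens'[OF trivial_limit_at_right_real this] obtain s where
      "\<forall>u\<in>verts f. s * norm (velocity f u) < r"
      "\<forall>u\<in>verts f. \<forall>v\<in>verts f. u \<noteq> v \<longrightarrow> s * norm (velocity f v - velocity f u) < norm (v - u) / 2"
      "s \<le> T" "0 < s"
    by auto
  note s = this(1,2)[rule_format] this(3,4)
  let ?q = "front f s"
  show ?thesis
  proof (rule that[OF s(4,3)])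
    \<comment> \<open>The bound \<open>r\<close> keeps the outer ends in the disc about their
      vertex. The bound \<open>s\<close> puts them below the wavefront of each of the edges at the
      vertex, including the edge that they do not lie on.\<close>
    have "\<forall>\<^sub>F k in at_right (0::real). \<forall>u\<in>verts f. \<forall>v\<in>verts f. k * norm (v - u) < min r s"
      using r s by (intro eventually_ball_finite ballI finite_verts eventually_mult_less) auto
    moreover have "\<forall>\<^sub>F k in at_right (0::real). k * 1 < 1 / 2"
      by (rule eventually_mult_less) auto
    moreover note eventually_at_right_less[of "0::real"]
    ultimately show "\<forall>\<^sub>F k in at_right 0. clear_spokes f s k"
    proof eventually_elim
      case (elim k)
      \<comment> \<open>The outer end \<open>u\<close> is treated as a cut point with ratio 0 on an
        arbitrary edge at \<open>u\<close>, so that both kinds of outer end are handled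
        alike.\<close>
      have target: "\<exists>v j. {u, v} \<in> edges f \<and> u \<noteq> v \<and> v \<in> verts f \<and> z = u + j *\<^sub>R (v - u)
          \<and> 0 \<le> j \<and> j \<le> 1/2 \<and> j * norm (v - u) < r \<and> j * norm (v - u) < s"
        if uz: "u \<in> verts f" "z \<in> targets k f u" for u z
      proof (cases "z = u")
        case True
        obtain e where "e \<in> edges f" "u \<in> e" using vert_in_edge uz by metis
        then obtain v where "{u, v} \<in> edges f" "u \<noteq> v" "v \<in> verts f" using edge_otherE by metis
        then show ?thesis
          using True r s by (intro exI[of _ v] exI[of _ 0]) auto
      next
        case False
        then obtain e where e: "e \<in> edges f" "u \<in> e" "z = cut k e u"
          using uz by (auto simp: targets_def)
        then obtain v where "e = {u, v}" "u \<noteq> v" "v \<in> verts f" using edge_otherE by metis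
        then show ?thesis
          using e elim uz by (intro exI[of _ v] exI[of _ k]) (auto simp: cut_doubleton)
      qed
      have near: "closed_segment (?q u) z \<subseteq> ball u r" if uz: "u \<in> verts f" "z \<in> targets k f u" for u z
      proof (rule closed_segment_subset)
        show "?q u \<in> ball u r"
          using s(1)[OF uz(1)] s(4) by (simp add: front_def dist_norm)
        show "z \<in> ball u r"
          using target[OF uz] by (auto simp: dist_norm)
      qed auto
      have inside: "closed_segment (?q u) z \<subseteq> insert z (inside C)"
        if uz: "u \<in> verts f" "z \<in> targets k f u" for u z
      proof
        fix x assume "x \<in> closed_segment (?q u) z"
        then obtain l where l: "x = (1 - l) *\<^sub>R ?q u + l *\<^sub>R z" "0 \<le> l" "l \<le> 1"
          by (auto simp: in_segment)
        obtain v j where v: "{u, v} \<in> edges f" "u \<noteq> v" "v \<in> verts f" "z = u + j *\<^sub>R (v - u)" "0 \<le> j" "j \<le> 1/2"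
          using target[OF uz] by blast
        show "x \<in> insert z (inside C)"
        proof (cases "l = 1")
          case False
          \<comment> \<open>The point at parameter \<open>l\<close> of the spoke has the strip
            coordinates \<open>(1 - l) * s\<close> and \<open>l * j\<close>.\<close>
          define y where "y = (1 - l) * s"
          have y: "0 < y" "y \<le> s"
            using l s False by (auto simp: y_def mult_le_cancel_right2)
          obtain c where c: "velocity f v - velocity f u = c *\<^sub>R (v - u)"
            using velocity_diff[OF v(1,2)] by blast
          have "s * \<bar>c\<bar> * norm (v - u) < 1 / 2 * norm (v - u)"
            using s(2)[OF uz(1) v(3,2)] unfolding c by (simp add: mult.assoc)
          then have "s * \<bar>c\<bar> < 1/2"
            using mult_right_less_imp_less norm_ge_zero by blast
          moreover have "\<bar>y * c\<bar> \<le> s * \<bar>c\<bar>"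
            using y by (simp add: abs_mult mult_right_mono)
          ultimately have yc: "1/2 < 1 + y * c" by linarith
          have "l * j \<le> 1 * (1/2)"
            using l v by (intro mult_mono) auto
          then have "u + y *\<^sub>R velocity f u + (l * j) *\<^sub>R (v - u) \<in> inside C"
            using y yc l v s by (intro strip_in_inside[OF v(1) c]) auto
          moreover have "x = u + y *\<^sub>R velocity f u + (l * j) *\<^sub>R (v - u)"
            unfolding l(1) v(4) y_def front_def by (simp add: algebra_simps)
          ultimately show ?thesis by simp
        qed (use l in simp)
      qed
      have avoid: "closed_segment (?q u) z \<inter> convex hull (?q ` e) \<subseteq> {?q u} \<inter> ?q ` e"
        if uz: "u \<in> verts f" "z \<in> targets k f u" and e: "e \<in> edges f" for u z e
      proof
        fix x assume x: "x \<in> closed_segment (?q u) z \<inter> convex hull (?q ` e)"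
        then obtain l where l: "x = (1 - l) *\<^sub>R ?q u + l *\<^sub>R z" "0 \<le> l" "l \<le> 1"
          by (auto simp: in_segment)
        obtain v j where v: "{u, v} \<in> edges f" "u \<noteq> v" "v \<in> verts f" "z = u + j *\<^sub>R (v - u)" "0 \<le> j"
            "j * norm (v - u) < s"
          using target[OF uz] by blast
        show "x \<in> {?q u} \<inter> ?q ` e"
        proof (cases "u \<in> e")
          case True
          have xu: "x - u = ((1 - l) * s) *\<^sub>R velocity f u + (l * j) *\<^sub>R (v - u)"
            unfolding l(1) v(4) front_def by (simp add: algebra_simps)
          \<comment> \<open>Along the spoke the height over \<open>e\<close> is affine, starting at
            \<open>s\<close> and ending below \<open>s\<close>. The wavefront has height
            \<open>s\<close>, so they can meet at \<open>l = 0\<close> only.\<close>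
          have "s = (x - u) \<bullet> normal f e"
            using front_height[OF e True] x by auto
          also have "\<dots> = (1 - l) * s + l * (j * ((v - u) \<bullet> normal f e))"
            unfolding xu inner_add_left using velocity_normal[OF e True] by simp
          finally have "l * (s - j * ((v - u) \<bullet> normal f e)) = 0"
            by (simp add: algebra_simps)
          moreover have "j * ((v - u) \<bullet> normal f e) \<le> j * norm (v - u)"
            using norm_cauchy_schwarz[of "v - u" "normal f e"] norm_normal[OF e] v(5)
            by (intro mult_left_mono) auto
          ultimately have "l = 0" using v(6) by auto
          then show ?thesis using l True by simp
        next
          case False
          obtain a b where ab: "e = {a, b}" "a \<in> verts f" "b \<in> verts f" using edgeE e by metis
          then have "x \<in> closed_segment (?q a) (?q b)"
            using x by (simp add: segment_convex_hull)
          then obtain h where h: "x = (1 - h) *\<^sub>R ?q a + h *\<^sub>R ?q b" "0 \<le> h" "h \<le> 1"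
            by (auto simp: in_segment)
          \<comment> \<open>\<open>x0\<close> is the point of \<open>e\<close> at the same parameter
            as the wavefront point \<open>x\<close>, less than \<open>r\<close> away from it. As
            \<open>x\<close> is also within \<open>r\<close> of \<open>u\<close>, the vertex would
            be too close to \<open>e\<close>.\<close>
          define x0 where "x0 = (1 - h) *\<^sub>R a + h *\<^sub>R b"
          have "x - x0 = (1 - h) *\<^sub>R (s *\<^sub>R velocity f a) + h *\<^sub>R (s *\<^sub>R velocity f b)"
            unfolding h(1) x0_def front_def by (simp add: algebra_simps)
          then have "x - x0 \<in> closed_segment (s *\<^sub>R velocity f a) (s *\<^sub>R velocity f b)"
            using h by (auto simp: in_segment)
          also have "\<dots> \<subseteq> ball 0 r"
            using s ab by (intro closed_segment_subset) auto
          finally have "dist x x0 < r" by (simp add: dist_norm norm_minus_commute)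
          moreover have "dist u x < r"
            using near[OF uz] x by auto
          moreover have "x0 \<in> closed_segment a b"
            unfolding x0_def in_segment using h by blast
          then have "x0 \<in> convex hull e"
            by (simp add: ab segment_convex_hull)
          then have "infdist u (convex hull e) \<le> dist u x0"
            by (rule infdist_le)
          then have "r * 2 < dist u x0"
            using r(1)[OF uz(1) e False] by simp
          ultimately show ?thesis
            using dist_triangle[of u x0 x] by auto
        qed
      qed
      have "closed_segment (?q u) z \<inter> closed_segment (?q u') z' = {}"
        if uz: "u \<in> verts f" "z \<in> targets k f u" "u' \<in> verts f" "z' \<in> targets k f u'" "u \<noteq> u'" for u z u' z'
      proof (rule ccontr)
        assume "closed_segment (?q u) z \<inter> closed_segment (?q u') z' \<noteq> {}"
        then obtain x where "dist u x < r" "dist u' x < r"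
          using near[OF uz(1,2)] near[OF uz(3,4)] by (auto simp: subset_iff)
        moreover have "r * 2 < dist u u'" using r(2) uz by auto
        ultimately show False
          using dist_triangle[of u u' x] by (simp add: dist_commute)
      qed
      with inside avoid show ?case
        unfolding clear_spokes_def by blast
    qed
  qed
qed

end

section \<open>Complexes with holes and outside\<close>

lemma hull_doubleton_inj:
  fixes a b c d :: complex
  shows "convex hull {a, b} = convex hull {c, d} \<Longrightarrow> {a, b} = {c, d}"
  by (simp flip: segment_convex_hull)

locale complex_with_holes =
  fixes K H :: "polygon set" and Out :: polygon and t :: "polygon \<Rightarrow> real"
  assumes fin: "finite K"
    and cpx: "polygonal_complex K"
    and holes: "holes_and_outside K H Out"
    and adm: "\<And>f. f \<in> K \<Longrightarrow> admissible_offset f (t f)"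
begin

abbreviation "B \<equiv> H \<union> {Out}"
abbreviation "bd f \<equiv> chain_image (corners f)"
abbreviation "I f \<equiv> inside (bd f)"
abbreviation "skel \<equiv> \<Union>f\<in>K. bd f"

lemma poly: "f \<in> K \<Longrightarrow> offset_polygon f (t f)"
  using cpx adm by (simp add: offset_polygon_def polygonal_complex_def)

lemma region_eq: "f \<in> K \<Longrightarrow> region f = bd f \<union> I f"
  using cpx by (simp add: polygonal_complex_def simple_polygon_def)

lemma vert_in_bd: "v \<in> verts f \<Longrightarrow> v \<in> bd f"
  by (force simp: verts_def in_set_conv_nth chain_image_side side_def intro: hull_inc)

lemma faces_subset_bd: "F \<in> faces f \<Longrightarrow> F \<subseteq> bd f"
  using vert_in_bd by (auto simp: faces_def chain_image_def edges_def)

lemma region_meet: "f \<in> K \<Longrightarrow> g \<in> K \<Longrightarrow> f \<noteq> g \<Longrightarrow> region f \<inter> region g \<subseteq> bd f"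
  using cpx faces_subset_bd unfolding polygonal_complex_def by (metis Int_iff empty_subsetI)

lemma hole_meet: "f \<in> K \<Longrightarrow> h \<in> B \<Longrightarrow> region f \<inter> region h \<subseteq> bd f"
proof -
  assume "f \<in> K" "h \<in> B"
  then have "region f \<inter> region h = \<Union>(faces f \<inter> faces h)"
    using holes unfolding holes_and_outside_def by metis
  then show ?thesis using faces_subset_bd by blast
qed

lemma inside_Int_bd: "f \<in> K \<Longrightarrow> I f \<inter> bd f = {}"
  by (rule inside_no_overlap)

lemma inside_disjoint: "f \<in> K \<Longrightarrow> g \<in> K \<Longrightarrow> f \<noteq> g \<Longrightarrow> I f \<inter> region g = {}"
  using region_meet[of f g] region_eq[of f] inside_Int_bd[of f] by blast

lemma inside_Int_hole: "f \<in> K \<Longrightarrow> h \<in> B \<Longrightarrow> I f \<inter> region h = {}"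
  using hole_meet[of f h] region_eq[of f] inside_Int_bd[of f] by blast

lemma inside_Int_skel: "f \<in> K \<Longrightarrow> I f \<inter> skel = {}"
  using inside_disjoint[of f] inside_Int_bd[of f] region_eq by blast

lemma hull_subset_skel: "e \<in> complex_edges K \<Longrightarrow> convex hull e \<subseteq> skel"
  by (auto simp: complex_edges_def chain_image_def edges_def)

lemma vert_in_skel: "v \<in> complex_verts K \<Longrightarrow> v \<in> skel"
  using vert_in_bd by (auto simp: complex_verts_def)

lemma edge_doubleton:
  "f \<in> K \<Longrightarrow> e \<in> edges f \<Longrightarrow> \<exists>a b. e = {a, b} \<and> a \<noteq> b \<and> a \<in> verts f \<and> b \<in> verts f"
  using offset_polygon.edgeE[OF poly] by metis

lemma edge_subset_verts: "f \<in> K \<Longrightarrow> e \<in> edges f \<Longrightarrow> e \<subseteq> verts f"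
  using offset_polygon.edgeE[OF poly] by (metis empty_subsetI insert_subset)

lemma complex_edge_subset_verts: "e \<in> complex_edges K \<Longrightarrow> e \<subseteq> complex_verts K"
  using edge_subset_verts by (auto simp: complex_edges_def complex_verts_def)

text \<open>Two polygons with a common point share exactly a vertex or exactly an edge
  \<open>e1\<close>. A shared vertex is an end of both edges; otherwise each of the two edges equals
  \<open>e1\<close> or meets it in common ends, and they cannot both equal it.\<close>

lemma complex_noncrossing:
  assumes "e \<in> complex_edges K" "e' \<in> complex_edges K" "e \<noteq> e'"
  shows "convex hull e \<inter> convex hull e' \<subseteq> e \<inter> e'"
proof
  fix x assume x: "x \<in> convex hull e \<inter> convex hull e'"
  obtain f g where fg: "f \<in> K" "e \<in> edges f" "g \<in> K" "e' \<in> edges g"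
    using assms by (auto simp: complex_edges_def)
  interpret f: offset_polygon f "t f" using poly fg by simp
  interpret g: offset_polygon g "t g" using poly fg by simp
  show "x \<in> e \<inter> e'"
  proof (cases "f = g")
    case True
    then show ?thesis using f.noncrossing[of e e'] x fg assms by blast
  next
    case False
    have "x \<in> region f \<inter> region g"
      using x fg f.edge_subset_C g.edge_subset_C region_eq by blast
    then have F: "x \<in> region f \<inter> region g" "region f \<inter> region g \<in> faces f" "region f \<inter> region g \<in> faces g"
      using cpx fg False unfolding polygonal_complex_def by blast+
    \<comment> \<open>A proper segment is not a point, so the common face cannot be a vertex of one
      polygon and an edge of the other.\<close>
    have single: "convex hull e1 \<noteq> {w}" if e1: "e1 \<in> edges f \<or> e1 \<in> edges g" for e1 w
    proof
      assume w: "convex hull e1 = {w}"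
      obtain a b where "e1 = {a, b}" "a \<noteq> b" using e1 edge_doubleton fg by blast
      then show False
        using w hull_inc[of a e1 convex] hull_inc[of b e1 convex] by (metis insertI1 insertI2 singletonD)
    qed
    \<comment> \<open>The common face is only a point set that occurs among the faces of
      \<open>f\<close> and among those of \<open>g\<close>; it has to be recognised as the same
      vertex or the same edge of both.\<close>
    consider v where "region f \<inter> region g = {v}" "v \<in> verts f" "v \<in> verts g"
      | e1 where "region f \<inter> region g = convex hull e1" "e1 \<in> edges f" "e1 \<in> edges g"
    proof -
      have "\<exists>e1. region f \<inter> region g = convex hull e1 \<and> e1 \<in> edges f \<and> e1 \<in> edges g"
        if no: "\<not> (\<exists>v. region f \<inter> region g = {v} \<and> v \<in> verts f \<and> v \<in> verts g)"
      proof -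
        obtain e1 e2 where e12: "e1 \<in> edges f" "region f \<inter> region g = convex hull e1"
            "e2 \<in> edges g" "region f \<inter> region g = convex hull e2"
        proof -
          have "(\<exists>v\<in>verts f. region f \<inter> region g = {v}) \<or> (\<exists>e1\<in>edges f. region f \<inter> region g = convex hull e1)"
               "(\<exists>v\<in>verts g. region f \<inter> region g = {v}) \<or> (\<exists>e1\<in>edges g. region f \<inter> region g = convex hull e1)"
            using F(2,3) unfolding faces_def by blast+
          then show ?thesis
          proof (elim disjE bexE)
            fix v w assume "v \<in> verts f" "region f \<inter> region g = {v}" "w \<in> verts g" "region f \<inter> region g = {w}"
            then show ?thesis using no by auto
          next
            fix v e assume "region f \<inter> region g = {v}" "e \<in> edges g" "region f \<inter> region g = convex hull e"
            then show ?thesis using single[of e v] by simp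
          next
            fix v e assume "region f \<inter> region g = {v}" "e \<in> edges f" "region f \<inter> region g = convex hull e"
            then show ?thesis using single[of e v] by simp
          qed (rule that)
        qed
        moreover obtain a b c d where "e1 = {a, b}" "e2 = {c, d}"
          using edge_doubleton[OF fg(1) e12(1)] edge_doubleton[OF fg(3) e12(3)] by auto
        ultimately have "e1 = e2" using hull_doubleton_inj by simp
        then show ?thesis using e12 by blast
      qed
      then show ?thesis using that by blast
    qed
    then show ?thesis
    proof cases
      case 1
      then show ?thesis
        using F(1) x fg f.vert_in_hull g.vert_in_hull by auto
    next
      case 2
      then have "x \<in> e \<inter> e1 \<or> e = e1" "x \<in> e' \<inter> e1 \<or> e' = e1"
        using f.noncrossing[of e e1] g.noncrossing[of e' e1] F(1) x fg by blast+
      then show ?thesis using assms(3) by blast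
    qed
  qed
qed

lemma complex_vert_in_hull:
  assumes "v \<in> complex_verts K" "e \<in> complex_edges K" "v \<in> convex hull e"
  shows "v \<in> e"
proof -
  obtain f where f: "f \<in> K" "v \<in> verts f" using assms by (auto simp: complex_verts_def)
  then obtain e' where "e' \<in> edges f" "v \<in> e'"
    using offset_polygon.vert_in_edge[OF poly] by metis
  then have e': "e' \<in> complex_edges K" "v \<in> e'" using f by (auto simp: complex_edges_def)
  then show ?thesis
    using complex_noncrossing[OF assms(2) e'(1)] assms(3) hull_inc[OF e'(2)] by blast
qed

section \<open>The two sides of an edge\<close>

lemma ray_tendsto: "((\<lambda>r. a + r *\<^sub>R n) \<longlongrightarrow> a) (at_right 0)" for a n :: complex
  by (auto intro!: tendsto_eq_intros)

text \<open>Both normals are unit vectors orthogonal to the edge, hence equal up to sign. If they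
  were equal, the half discs at the midpoint would put common points into the disjoint insides of
  \<open>f\<close> and \<open>g\<close>.\<close>

lemma shared_edge_normal:
  assumes "f \<in> K" "g \<in> K" "f \<noteq> g" "e \<in> edges f" "e \<in> edges g"
  shows "normal g e = - normal f e"
proof -
  interpret f: offset_polygon f "t f" using poly assms by simp
  interpret g: offset_polygon g "t g" using poly assms by simp
  obtain u v where e: "e = {u, v}" "u \<noteq> v" using f.edgeE assms by metis
  let ?N = "normal f e" and ?N' = "normal g e"
  have N: "norm ?N = 1" "norm ?N' = 1" "(v - u) \<bullet> ?N = 0" "(v - u) \<bullet> ?N' = 0"
    using assms e f.norm_normal g.norm_normal f.normal_perp g.normal_perp by auto
  have "\<exists>r. ?N' = r *\<^sub>R ?N"
    using N e by (intro orthogonal_parallel[of _ "v - u"]) (auto simp: inner_commute)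
  then obtain r where r: "?N' = r *\<^sub>R ?N" by blast
  then have "\<bar>r\<bar> = 1" using N by simp
  moreover have "r \<noteq> 1"
  proof
    assume "r = 1"
    then have eq: "?N' = ?N" using r by simp
    have "\<forall>\<^sub>F z in nhds (midpoint u v). 0 < (z - u) \<bullet> ?N \<longrightarrow> z \<in> I f \<inter> I g"
      using f.half_disc[of u v] g.half_disc[of u v] assms e unfolding eq[unfolded e(1)]
      by (auto elim: eventually_elim2)
    then have "\<forall>\<^sub>F r in at_right (0::real). 0 < (midpoint u v + r *\<^sub>R ?N - u) \<bullet> ?N \<longrightarrow>
        midpoint u v + r *\<^sub>R ?N \<in> I f \<inter> I g"
      by (rule eventually_compose_filterlim[OF _ ray_tendsto])
    from eventually_happens'[OF trivial_limit_at_right_real eventually_conj[OF this eventually_at_right_less]]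
    obtain r :: real where "0 < r" and
      r: "0 < (midpoint u v + r *\<^sub>R ?N - u) \<bullet> ?N \<longrightarrow> midpoint u v + r *\<^sub>R ?N \<in> I f \<inter> I g"
      by blast
    have "midpoint u v + r *\<^sub>R ?N - u = (1/2) *\<^sub>R (v - u) + r *\<^sub>R ?N"
      by (simp add: midpoint_def complex_eq_iff field_simps)
    moreover have "((1/2) *\<^sub>R (v - u) + r *\<^sub>R ?N) \<bullet> ?N = r"
      using N unfolding inner_add_left inner_scaleR_left by (simp add: dot_square_norm)
    ultimately have "(midpoint u v + r *\<^sub>R ?N - u) \<bullet> ?N = r" by (simp only:)
    then show False
      using r \<open>0 < r\<close> inside_disjoint[of f g] region_eq assms by auto
  qed
  ultimately show ?thesis using r by (auto simp: abs_if split: if_splits)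
qed

text \<open>Three polygons at one edge would have pairwise opposite normals, which forces a unit
  vector to be its own negative.\<close>

lemma edge_in_two_polygons:
  assumes "f \<in> K" "g \<in> K" "h \<in> K" "f \<noteq> g" "f \<noteq> h" "e \<in> edges f" "e \<in> edges g" "e \<in> edges h"
  shows "g = h"
proof (rule ccontr)
  assume "g \<noteq> h"
  then have "normal h e = - normal g e" "normal g e = - normal f e" "normal h e = - normal f e"
    using assms by (intro shared_edge_normal; simp)+
  then have "normal f e = 0" by simp
  then show False using offset_polygon.norm_normal[OF poly] assms by (metis norm_zero zero_neq_one)
qed

text \<open>Two polygons of the complex fill both half discs at the midpoint of the edge. Near it,
  \<open>h\<close> could then have points on the line through the edge only, but its region is the
  closure of its interior.\<close>

lemma boundary_edge_not_shared:
  assumes "f \<in> K" "g \<in> K" "f \<noteq> g" "h \<in> B" "e \<in> edges f" "e \<in> edges g" "e \<in> edges h"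
  shows False
proof -
  interpret f: offset_polygon f "t f" using poly assms by simp
  interpret g: offset_polygon g "t g" using poly assms by simp
  obtain u v where e: "e = {u, v}" "u \<noteq> v" using f.edgeE assms by metis
  let ?N = "normal f e" and ?m = "midpoint u v"
  have N: "?N \<bullet> ?N = 1"
    using f.norm_normal assms by (simp add: dot_square_norm)
  have "normal g e = - ?N"
    using assms(1,2,3,5,6) by (rule shared_edge_normal)
  then have "\<forall>\<^sub>F z in nhds ?m. 0 < (z - u) \<bullet> ?N \<longrightarrow> z \<in> I f"
    "\<forall>\<^sub>F z in nhds ?m. 0 < (z - u) \<bullet> - ?N \<longrightarrow> z \<in> I g"
    using f.half_disc[of u v] g.half_disc[of u v] assms(5,6) e by auto
  then have "\<forall>\<^sub>F z in nhds ?m. (z - u) \<bullet> ?N \<noteq> 0 \<longrightarrow> z \<in> I f \<union> I g"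
    by eventually_elim (auto simp: linorder_neq_iff)
  then obtain U where U: "open U" "?m \<in> U" "\<And>z. z \<in> U \<Longrightarrow> (z - u) \<bullet> ?N \<noteq> 0 \<Longrightarrow> z \<in> I f \<union> I g"
    unfolding eventually_nhds by blast
  have "polygonal_face h"
    using holes assms by (auto simp: holes_and_outside_def hole_polygon_def outside_polygon_def)
  then have h: "frontier (region h) = bd h" "closure (interior (region h)) = region h"
    by (auto simp: polygonal_face_def)
  have "?m \<in> convex hull e"
    using midpoint_in_closed_segment by (simp add: e flip: segment_convex_hull)
  then have "?m \<in> bd h"
    using assms by (auto simp: chain_image_def edges_def)
  then have "?m \<in> closure (interior (region h))"
    using h frontier_subset_closed[of "region h"] closed_closure[of "interior (region h)"] by auto
  then have "U \<inter> interior (region h) \<noteq> {}"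
    using U(1,2) open_Int_closure_eq_empty[of U "interior (region h)"] by blast
  then obtain z where z: "z \<in> U \<inter> interior (region h)" by blast
  have out: "x \<notin> I f \<union> I g" if "x \<in> U \<inter> interior (region h)" for x
    using that inside_Int_hole[of f h] inside_Int_hole[of g h] assms interior_subset[of "region h"] by blast
  then have y0: "(z - u) \<bullet> ?N = 0" using U(3) z by blast
  \<comment> \<open>An interior point of \<open>h\<close> on the line can be pushed along the
    normal, off the line, without leaving the interior.\<close>
  have "\<forall>\<^sub>F r in at_right 0. z + r *\<^sub>R ?N \<in> U \<inter> interior (region h)"
    using z U by (intro topological_tendstoD[OF ray_tendsto]) auto
  from eventually_happens'[OF trivial_limit_at_right_real eventually_conj[OF this eventually_at_right_less]]
  obtain r :: real where r: "0 < r" "z + r *\<^sub>R ?N \<in> U \<inter> interior (region h)" by blast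
  have "(z + r *\<^sub>R ?N - u) \<bullet> ?N = (z - u) \<bullet> ?N + r * (?N \<bullet> ?N)"
    by (simp add: inner_add_left inner_diff_left)
  then have "(z + r *\<^sub>R ?N - u) \<bullet> ?N \<noteq> 0" using y0 N r by simp
  then show False using U(3) out r by blast
qed

text \<open>Each polygon gets its own offset \<open>s f\<close>. The ratio \<open>k\<close> is
  common to all of them, as the spokes of two neighbours must end in the same cut point; finiteness
  of \<open>K\<close> makes such a choice possible.\<close>

lemma drawing_scale:
  obtains s k where "\<And>f. f \<in> K \<Longrightarrow> 0 < s f" "\<And>f. f \<in> K \<Longrightarrow> s f \<le> t f"
    "\<And>f. f \<in> K \<Longrightarrow> clear_spokes f (s f) k" "0 < k" "k < 1/2"
proof -
  have "\<forall>f\<in>K. \<exists>s. 0 < s \<and> s \<le> t f \<and> (\<forall>\<^sub>F k in at_right 0. clear_spokes f s k)"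
    using offset_polygon.spokes[OF poly] by metis
  then obtain s where s: "\<forall>f\<in>K. 0 < s f \<and> s f \<le> t f \<and> (\<forall>\<^sub>F k in at_right 0. clear_spokes f (s f) k)"
    by metis
  have "\<forall>\<^sub>F k in at_right (0::real). (\<forall>f\<in>K. clear_spokes f (s f) k) \<and> k * 1 < 1/2 \<and> 0 < k"
    using s by (intro eventually_conj eventually_ball_finite fin eventually_mult_less eventually_at_right_less) auto
  from eventually_happens'[OF trivial_limit_at_right_real this] show ?thesis
    using that s by auto
qed

end

section \<open>The drawing\<close>

locale drawing = complex_with_holes +
  fixes s :: "polygon \<Rightarrow> real" and k :: real
  assumes s: "\<And>f. f \<in> K \<Longrightarrow> 0 < s f" "\<And>f. f \<in> K \<Longrightarrow> s f \<le> t f"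
    and clear: "\<And>f. f \<in> K \<Longrightarrow> clear_spokes f (s f) k"
    and k: "0 < k" "k < 1/2"
begin

abbreviation "copy \<equiv> vcopy K t"
abbreviation "Q f \<equiv> front f (s f)"
abbreviation "spoke f u z \<equiv> closed_segment (Q f u) z"

section \<open>Positions of the vertices\<close>

lemma copy_eq:
  assumes "f \<in> K" "u \<in> verts f" shows "copy f u = front f (t f) u"
proof -
  interpret offset_polygon f "t f" using poly assms by simp
  obtain i where i: "i < length (corners f)" "u = corners f ! i"
    using assms by (auto simp: verts_def in_set_conv_nth)
  have "copy f u = miter_corner f (t f) (corner_index f u)"
    using assms by (simp add: vcopy_def corner_index_def)
  then show ?thesis
    using i by (simp add: miter_corner_eq)
qed

text \<open>A positive offset puts the corner into the inside of its polygon. Insides are disjoint,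
  which identifies the polygon, and the wavefront is injective, which identifies the vertex. The
  offset \<open>r\<close> is arbitrary so that both \<open>t\<close> and \<open>s\<close> are
  covered.\<close>

lemma front_copies:
  assumes "\<And>f. f \<in> K \<Longrightarrow> 0 < r f \<and> r f \<le> t f" "f \<in> K" "g \<in> K" "u \<in> verts f" "v \<in> verts g"
    "front f (r f) u = front g (r g) v"
  shows "f = g \<and> u = v"
proof -
  interpret f: offset_polygon f "t f" using poly assms by simp
  interpret g: offset_polygon g "t g" using poly assms by simp
  have r: "0 < r f" "r f \<le> t f" "0 < r g" "r g \<le> t g" using assms(1-3) by auto
  have "front f (r f) u \<in> I f" using r(1,2) assms(4) by (rule f.front_vert_in_interior)
  moreover have "front g (r g) v \<in> I g" using r(3,4) assms(5) by (rule g.front_vert_in_interior)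
  ultimately have "f = g"
    using inside_disjoint[of f g] assms(2,3,6) region_eq[of g] by auto
  moreover have "inj_on (front f (r f)) (verts f)"
    using r(1,2) by (intro f.front_inj) auto
  ultimately show ?thesis
    using assms(4-6) by (auto dest: inj_onD)
qed

lemma t_pos: "f \<in> K \<Longrightarrow> 0 < t f"
  using poly offset_polygon.T_pos by metis

lemma copy_inj: "f \<in> K \<Longrightarrow> g \<in> K \<Longrightarrow> u \<in> verts f \<Longrightarrow> v \<in> verts g \<Longrightarrow> copy f u = copy g v \<Longrightarrow> f = g \<and> u = v"
  using front_copies[of t f g u v] t_pos by (simp add: copy_eq)

lemma Q_inj: "f \<in> K \<Longrightarrow> g \<in> K \<Longrightarrow> u \<in> verts f \<Longrightarrow> v \<in> verts g \<Longrightarrow> Q f u = Q g v \<Longrightarrow> f = g \<and> u = v"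
  using front_copies[of s f g u v] s by simp

lemma Q_inside: "f \<in> K \<Longrightarrow> u \<in> verts f \<Longrightarrow> Q f u \<in> I f"
  using offset_polygon.front_vert_in_interior[OF poly] s by simp

lemma copy_inside: "f \<in> K \<Longrightarrow> u \<in> verts f \<Longrightarrow> copy f u \<in> I f"
  using offset_polygon.front_vert_in_interior[OF poly] t_pos by (simp add: copy_eq)

lemma copy_not_vert: "f \<in> K \<Longrightarrow> u \<in> verts f \<Longrightarrow> v \<in> complex_verts K \<Longrightarrow> copy f u \<noteq> v"
  using copy_inside[of f u] inside_Int_skel[of f] vert_in_skel[of v] by auto

text \<open>The vertices of the graph are points of the plane, so the passage from offset
  \<open>t f\<close> to offset \<open>s f\<close> has to be a map on points. It is well defined
  because a copy determines its polygon and its vertex, by \<open>copy_inj\<close>.\<close>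

definition place :: "complex \<Rightarrow> complex" where
  "place x = (if \<exists>f u. f \<in> K \<and> u \<in> verts f \<and> x = copy f u
              then THE y. \<exists>f u. f \<in> K \<and> u \<in> verts f \<and> x = copy f u \<and> y = Q f u else x)"

lemma place_copy [simp]:
  assumes "f \<in> K" "u \<in> verts f" shows "place (copy f u) = Q f u"
proof -
  have "(THE y. \<exists>g v. g \<in> K \<and> v \<in> verts g \<and> copy f u = copy g v \<and> y = Q g v) = Q f u"
  proof (rule the_equality)
    fix y assume "\<exists>g v. g \<in> K \<and> v \<in> verts g \<and> copy f u = copy g v \<and> y = Q g v"
    then obtain g v where "g \<in> K" "v \<in> verts g" "copy f u = copy g v" "y = Q g v" by blast
    then show "y = Q f u" using copy_inj[of f g u v] assms by simp
  qed (use assms in blast)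
  then show ?thesis
    using assms by (auto simp: place_def)
qed

lemma place_vert [simp]: "v \<in> complex_verts K \<Longrightarrow> place v = v"
  using copy_not_vert by (auto simp: place_def)

text \<open>An upper bound for the vertices of the graph: it contains interior vertices of the
  complex too, and the drawing avoids these as well.\<close>

definition new_verts :: "complex set" where
  "new_verts = {copy f u | f u. f \<in> K \<and> u \<in> verts f} \<union> complex_verts K"

lemma place_inj: "inj_on place new_verts"
proof (rule inj_onI)
  fix x y assume "x \<in> new_verts" "y \<in> new_verts" "place x = place y"
  moreover have "Q f u \<noteq> v" if "f \<in> K" "u \<in> verts f" "v \<in> complex_verts K" for f u v
    using Q_inside[of f u] inside_Int_skel[of f] vert_in_skel[of v] that by auto
  ultimately show "x = y"
    unfolding new_verts_def using Q_inj by (auto; metis)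
qed

text \<open>From \<open>0 < k\<close> and \<open>k < 1/2\<close>, a cut point is a relative interior
  point of its edge on the near side of the middle. By the noncrossing of edges it determines both
  the edge and the end from which it was cut.\<close>

lemma cut_props:
  assumes "e \<in> complex_edges K" "u \<in> e"
  shows "cut k e u \<in> convex hull e" "cut k e u \<notin> complex_verts K"
    "\<And>e'. e' \<in> complex_edges K \<Longrightarrow> cut k e u \<in> convex hull e' \<Longrightarrow> e' = e"
    "\<And>v. v \<in> e \<Longrightarrow> cut k e u = cut k e v \<Longrightarrow> u = v"
proof -
  obtain f where "f \<in> K" "e \<in> edges f" using assms by (auto simp: complex_edges_def)
  then obtain v where e: "e = {u, v}" "u \<noteq> v"
    using offset_polygon.edge_otherE[OF poly] assms(2) by metis
  have c: "cut k e u = u + k *\<^sub>R (v - u)" and c': "cut k e v = v + k *\<^sub>R (u - v)"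
    using e cut_doubleton[of u v k] cut_doubleton[of v u k] by (auto simp: insert_commute)
  have "cut k e u = (1 - k) *\<^sub>R u + k *\<^sub>R v"
    unfolding c by (simp add: algebra_simps)
  then have "cut k e u \<in> closed_segment u v"
    unfolding in_segment using k by (intro exI[of _ k]) auto
  then show hull: "cut k e u \<in> convex hull e"
    by (simp add: e segment_convex_hull)
  have "cut k e u - u = k *\<^sub>R (v - u)" "cut k e u - v = (1 - k) *\<^sub>R (u - v)" "cut k e u - cut k e v = (1 - 2 * k) *\<^sub>R (u - v)"
    unfolding c c' by (simp_all add: scaleR_conv_of_real algebra_simps)
  then have ne: "cut k e u \<notin> e" "cut k e u \<noteq> cut k e v"
    using k e by auto
  then show nv: "cut k e u \<notin> complex_verts K"
    using complex_vert_in_hull[OF _ assms(1) hull] by blast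
  show "e' = e" if "e' \<in> complex_edges K" "cut k e u \<in> convex hull e'" for e'
    using complex_noncrossing[OF assms(1) that(1)] hull that(2) ne(1) by auto
  show "u = w" if "w \<in> e" "cut k e u = cut k e w" for w
    using that ne(2) e(1) by auto
qed

lemma target_in_skel:
  assumes "f \<in> K" "u \<in> verts f" "z \<in> targets k f u" shows "z \<in> skel"
proof (cases "z = u")
  case True
  then show ?thesis using assms vert_in_bd by auto
next
  case False
  then obtain e where "e \<in> complex_edges K" "u \<in> e" "z = cut k e u"
    using assms by (auto simp: targets_def complex_edges_def)
  then show ?thesis using cut_props(1) hull_subset_skel by blast
qed

lemma spoke_inside: "f \<in> K \<Longrightarrow> u \<in> verts f \<Longrightarrow> z \<in> targets k f u \<Longrightarrow> spoke f u z \<subseteq> insert z (I f)"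
  and spoke_side: "f \<in> K \<Longrightarrow> u \<in> verts f \<Longrightarrow> z \<in> targets k f u \<Longrightarrow> e \<in> edges f \<Longrightarrow>
    spoke f u z \<inter> convex hull (Q f ` e) \<subseteq> {Q f u} \<inter> Q f ` e"
  and spoke_spoke: "f \<in> K \<Longrightarrow> u \<in> verts f \<Longrightarrow> z \<in> targets k f u \<Longrightarrow> u' \<in> verts f \<Longrightarrow>
    z' \<in> targets k f u' \<Longrightarrow> u \<noteq> u' \<Longrightarrow> spoke f u z \<inter> spoke f u' z' = {}"
  using clear unfolding clear_spokes_def by blast+

text \<open>The two segments lie on one ray from \<open>q\<close>, so one contains the other. The
  shorter one is that on which \<open>x\<close> has the larger parameter.\<close>

lemma segments_overlap:
  fixes q z z' :: complex
  assumes "x \<in> closed_segment q z" "x \<in> closed_segment q z'" "x \<noteq> q"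
  shows "z' \<in> closed_segment q z \<or> z \<in> closed_segment q z'"
proof -
  have *: "z' \<in> closed_segment q z"
    if x: "x = (1 - a) *\<^sub>R q + a *\<^sub>R z" "x = (1 - b) *\<^sub>R q + b *\<^sub>R z'" and ab: "0 \<le> a" "a \<le> b" 
    for a b and z z' :: complex
  proof -
    have "b \<noteq> 0" using x assms(3) by auto
    have "b *\<^sub>R z' = (b - a) *\<^sub>R q + a *\<^sub>R z"
      using x by (simp add: algebra_simps)
    then have "(1 / b) *\<^sub>R (b *\<^sub>R z') = (1 / b) *\<^sub>R ((b - a) *\<^sub>R q + a *\<^sub>R z)"
      by (rule arg_cong)
    then have "z' = (1 - a / b) *\<^sub>R q + (a / b) *\<^sub>R z"
      using \<open>b \<noteq> 0\<close> by (simp add: scaleR_add_right diff_divide_distrib)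
    moreover have "0 \<le> a / b" "a / b \<le> 1" using ab \<open>b \<noteq> 0\<close> by (auto simp: divide_simps)
    ultimately show ?thesis unfolding in_segment by blast
  qed
  obtain a b where "x = (1 - a) *\<^sub>R q + a *\<^sub>R z" "0 \<le> a" "x = (1 - b) *\<^sub>R q + b *\<^sub>R z'" "0 \<le> b"
    using assms unfolding in_segment by blast
  then show ?thesis
    using *[of a z b z'] *[of b z' a z] by linarith
qed

text \<open>Otherwise one of the two spokes would contain the outer end of the other, which lies on the
  boundary of \<open>f\<close>.\<close>
lemma spokes_at_vert:
  assumes f: "f \<in> K" "u \<in> verts f" and z: "z \<in> targets k f u" "z' \<in> targets k f u" "z \<noteq> z'"
  shows "spoke f u z \<inter> spoke f u z' \<subseteq> {Q f u}"
proof (rule ccontr)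
  assume "\<not> ?thesis"
  then obtain x where "x \<in> spoke f u z" "x \<in> spoke f u z'" "x \<noteq> Q f u" by blast
  then have "z' \<in> spoke f u z \<or> z \<in> spoke f u z'" by (rule segments_overlap)
  then have "z' \<in> I f \<or> z \<in> I f"
    using spoke_inside[OF f z(1)] spoke_inside[OF f z(2)] z(3) by blast
  then show False
    using target_in_skel[OF f z(1)] target_in_skel[OF f z(2)] inside_Int_skel[OF f(1)] by blast
qed

section \<open>Pieces of the drawn edges\<close>

definition side_piece :: "complex set \<Rightarrow> complex set \<Rightarrow> bool" where
  "side_piece E P \<longleftrightarrow> (\<exists>f e. f \<in> K \<and> e \<in> edges f \<and> E = copy f ` e \<and> P = convex hull (Q f ` e))"

definition boundary_piece :: "complex set \<Rightarrow> complex set \<Rightarrow> bool" where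
  "boundary_piece E P \<longleftrightarrow> (\<exists>f h. f \<in> K \<and> h \<in> B \<and> E \<in> edges f \<and> E \<in> edges h \<and> P = convex hull E)"

text \<open>\<open>E\<close> is the graph edge that the spoke helps to draw. For two polygons of the
  complex, both halves carry the same \<open>E\<close> and \<open>z\<close>. A hole or the outside
  is not recorded, since its copy of \<open>u\<close> is \<open>u\<close>.\<close>

definition spoke_end :: "polygon \<Rightarrow> complex \<Rightarrow> complex \<Rightarrow> complex set \<Rightarrow> bool" where
  "spoke_end f u z E \<longleftrightarrow> f \<in> K \<and> u \<in> verts f \<and>
     (z = u \<and> E = {copy f u, u} \<or>
      (\<exists>g e. g \<in> K \<and> f \<noteq> g \<and> e \<in> edges f \<and> e \<in> edges g \<and> u \<in> e \<and> z = cut k e u \<and> E = {copy f u, copy g u}))"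

definition spoke_piece :: "complex set \<Rightarrow> complex set \<Rightarrow> bool" where
  "spoke_piece E P \<longleftrightarrow> (\<exists>f u z. spoke_end f u z E \<and> P = spoke f u z)"

lemma spoke_end_props:
  assumes "spoke_end f u z E"
  shows "f \<in> K" "u \<in> verts f" "z \<in> targets k f u" "copy f u \<in> E" "Q f u \<in> place ` E"
    "u \<in> complex_verts K" "z \<in> skel"
proof -
  show *: "f \<in> K" "u \<in> verts f" "z \<in> targets k f u" "copy f u \<in> E"
    using assms by (auto simp: spoke_end_def targets_def)
  then show "Q f u \<in> place ` E"
    by (metis imageI place_copy)
  show "u \<in> complex_verts K" using * by (auto simp: complex_verts_def)
  show "z \<in> skel" using * by (intro target_in_skel)
qed

lemma spoke_end_inside: "spoke_end f u z E \<Longrightarrow> spoke f u z \<subseteq> insert z (I f)"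
  using spoke_end_props by (intro spoke_inside)

lemma side_inside: "f \<in> K \<Longrightarrow> e \<in> edges f \<Longrightarrow> convex hull (Q f ` e) \<subseteq> I f"
  using offset_polygon.front_in_interior[OF poly] s by simp

lemma side_noncrossing:
  "f \<in> K \<Longrightarrow> e \<in> edges f \<Longrightarrow> e' \<in> edges f \<Longrightarrow> e \<noteq> e' \<Longrightarrow>
    convex hull (Q f ` e) \<inter> convex hull (Q f ` e') \<subseteq> Q f ` (e \<inter> e')"
  using offset_polygon.front_noncrossing[OF poly, of f "s f" e e'] s[of f] by simp

lemma insides_disjoint: "f \<in> K \<Longrightarrow> g \<in> K \<Longrightarrow> x \<in> I f \<Longrightarrow> x \<in> I g \<Longrightarrow> f = g"
  using inside_disjoint[of f g] region_eq[of g] by auto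

lemma inside_not_skel: "f \<in> K \<Longrightarrow> x \<in> I f \<Longrightarrow> x \<notin> skel"
  using inside_Int_skel[of f] by blast

lemma edge_in_complex: "f \<in> K \<Longrightarrow> e \<in> edges f \<Longrightarrow> e \<in> complex_edges K"
  by (auto simp: complex_edges_def)

section \<open>Intersections of pieces\<close>

lemma side_side:
  assumes "side_piece E P" "side_piece E' P'" "E \<noteq> E'" "x \<in> P" "x \<in> P'"
  shows "x \<in> place ` (E \<inter> E')"
proof -
  obtain f e f' e' where fe: "f \<in> K" "e \<in> edges f" "E = copy f ` e" "P = convex hull (Q f ` e)"
      "f' \<in> K" "e' \<in> edges f'" "E' = copy f' ` e'" "P' = convex hull (Q f' ` e')"
    using assms unfolding side_piece_def by metis
  then have "x \<in> I f" "x \<in> I f'"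
    using side_inside[OF fe(1,2)] side_inside[OF fe(5,6)] assms by auto
  then have [simp]: "f' = f" using insides_disjoint[OF fe(1,5)] by blast
  then have "e \<noteq> e'" using fe assms(3) by auto
  then have "x \<in> Q f ` (e \<inter> e')"
    using side_noncrossing[of f e e'] fe(1,2,4,6,8) assms(4,5) by auto
  then obtain u where u: "u \<in> e" "u \<in> e'" "x = Q f u" by blast
  then have "x = place (copy f u)" "copy f u \<in> E \<inter> E'"
    using fe edge_subset_verts[OF fe(1,2)] by auto
  then show ?thesis by blast
qed

lemma side_boundary:
  assumes "side_piece E P" "boundary_piece E' P'" "x \<in> P" "x \<in> P'"
  shows False
proof -
  obtain f e where "f \<in> K" "e \<in> edges f" "P = convex hull (Q f ` e)"
    using assms unfolding side_piece_def by metis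
  then have "x \<notin> skel" using side_inside[of f e] inside_not_skel[of f] assms by auto
  moreover have "x \<in> skel"
    using assms hull_subset_skel edge_in_complex unfolding boundary_piece_def by blast
  ultimately show False by simp
qed

text \<open>The outer end of the spoke is on the skeleton, where no side of a wavefront goes. So
  both pieces meet inside one polygon, at the inner end of the spoke.\<close>

lemma side_spoke:
  assumes "side_piece E P" "spoke_piece E' P'" "x \<in> P" "x \<in> P'"
  shows "x \<in> place ` (E \<inter> E')"
proof -
  obtain f e where fe: "f \<in> K" "e \<in> edges f" "E = copy f ` e" "P = convex hull (Q f ` e)"
    using assms unfolding side_piece_def by metis
  obtain f' u z where sp: "spoke_end f' u z E'" "P' = spoke f' u z"
    using assms unfolding spoke_piece_def by metis
  note p = spoke_end_props[OF sp(1)]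
  have x: "x \<in> I f" using side_inside[OF fe(1,2)] fe assms by auto
  then have "x \<in> I f'"
    using spoke_end_inside[OF sp(1)] inside_not_skel[OF fe(1) x] sp(2) p(7) assms(4) by auto
  then have [simp]: "f' = f" using insides_disjoint[OF fe(1) p(1) x] by simp
  have "x \<in> {Q f u} \<inter> Q f ` e"
    using spoke_side[of f u z e] p(2,3) fe sp assms by auto
  then obtain v where v: "x = Q f u" "v \<in> e" "Q f v = Q f u" by auto
  then have "u = v"
    using Q_inj[of f f v u] fe edge_subset_verts[OF fe(1,2)] p by auto
  then have "u \<in> e" using v(2) by simp
  then have "copy f u \<in> E \<inter> E'" using fe(3) p(4) by simp
  moreover have "x = place (copy f u)" using v(1) p(1,2) by simp
  ultimately show ?thesis by blast
qed

lemma boundary_boundary: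
  assumes "boundary_piece E P" "boundary_piece E' P'" "E \<noteq> E'" "x \<in> P" "x \<in> P'"
  shows "x \<in> place ` (E \<inter> E')"
proof -
  have E: "E \<in> complex_edges K" "E' \<in> complex_edges K" "P = convex hull E" "P' = convex hull E'"
    using assms(1,2) edge_in_complex unfolding boundary_piece_def by auto
  then have "x \<in> E \<inter> E'" using complex_noncrossing[OF E(1,2) assms(3)] assms by auto
  moreover then have "x = place x" using complex_edge_subset_verts[OF E(1)] by auto
  ultimately show ?thesis by blast
qed

text \<open>Only the outer end of a spoke can lie on a boundary edge. If it is a vertex, it is an
  end of that edge. If it is a cut point, the boundary edge would lie between two polygons of the
  complex.\<close>

lemma boundary_spoke:
  assumes "boundary_piece E P" "spoke_piece E' P'" "x \<in> P" "x \<in> P'"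
  shows "x \<in> place ` (E \<inter> E')"
proof -
  obtain h where E: "E \<in> complex_edges K" "P = convex hull E" "h \<in> B" "E \<in> edges h"
    using assms(1) edge_in_complex unfolding boundary_piece_def by auto
  obtain f u z where sp: "spoke_end f u z E'" "P' = spoke f u z"
    using assms unfolding spoke_piece_def by metis
  note p = spoke_end_props[OF sp(1)]
  have "x \<in> skel" using hull_subset_skel[OF E(1)] E assms by auto
  then have [simp]: "x = z"
    using spoke_end_inside[OF sp(1)] inside_not_skel[OF p(1)] assms sp by auto
  from sp(1) consider "z = u" "E' = {copy f u, u}"
    | g e where "g \<in> K" "f \<noteq> g" "e \<in> edges f" "e \<in> edges g" "u \<in> e" "z = cut k e u"
    unfolding spoke_end_def by blast
  then show ?thesis
  proof cases
    case 1
    then have "u \<in> E \<inter> E'"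
      using complex_vert_in_hull[OF p(6) E(1)] E assms by auto
    then show ?thesis using 1 p(6) by (metis \<open>x = z\<close> image_eqI place_vert)
  next
    case 2
    then have "E = e"
      using cut_props(3)[of e u E] edge_in_complex[OF p(1)] E assms by auto
    then show ?thesis
      using boundary_edge_not_shared[OF p(1) 2(1,2) E(3)] 2 E by blast
  qed
qed

text \<open>On the skeleton, spokes can meet in a common outer end only; off the skeleton they run
  in the same polygon and must start from the same corner.\<close>

lemma spoke_spoke_piece:
  assumes "spoke_piece E P" "spoke_piece E' P'" "E \<noteq> E'" "x \<in> P" "x \<in> P'"
  shows "x \<in> place ` (E \<inter> E')"
proof -
  obtain f u z where sp: "spoke_end f u z E" "P = spoke f u z"
    using assms unfolding spoke_piece_def by metis
  obtain f' u' z' where sp': "spoke_end f' u' z' E'" "P' = spoke f' u' z'"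
    using assms unfolding spoke_piece_def by metis
  note p = spoke_end_props[OF sp(1)] and p' = spoke_end_props[OF sp'(1)]
  \<comment> \<open>A cut point determines its edge and vertex, and the edge has no third polygon,
    so a common cut point would give \<open>E = E'\<close>. A common outer end is therefore a
    vertex, reached from different polygons.\<close>
  have same: "f \<noteq> f' \<and> u = u' \<and> z = u" if "z = z'" "f = f' \<longrightarrow> u = u'"
  proof -
    from sp(1) consider (v) "z = u" "E = {copy f u, u}"
      | (c) g e where "g \<in> K" "f \<noteq> g" "e \<in> edges f" "e \<in> edges g" "u \<in> e" "z = cut k e u" "E = {copy f u, copy g u}"
      unfolding spoke_end_def by blast
    then show ?thesis
    proof cases
      case v
      from sp'(1) consider (v') "z' = u'" "E' = {copy f' u', u'}" | (c') e' where "e' \<in> edges f'" "u' \<in> e'" "z' = cut k e' u'"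
        unfolding spoke_end_def by blast
      then show ?thesis
      proof cases
        case v'
        then show ?thesis using v assms(3) that by auto
      next
        case c'
        then show ?thesis
          using cut_props(2)[of e' u'] edge_in_complex[OF p'(1)] p(6) v that by auto
      qed
    next
      case c
      then have cc: "e \<in> complex_edges K" using edge_in_complex p(1) by blast
      from sp'(1) consider (v') "z' = u'" | (c') g' e' where "g' \<in> K" "f' \<noteq> g'" "e' \<in> edges f'" "e' \<in> edges g'"
          "u' \<in> e'" "z' = cut k e' u'" "E' = {copy f' u', copy g' u'}"
        unfolding spoke_end_def by blast
      then show ?thesis
      proof cases
        case v'
        then show ?thesis
          using cut_props(2)[OF cc c(5)] p'(6) c that by auto
      next
        case c'
        then have cc': "e' \<in> complex_edges K" using edge_in_complex p'(1) by blast
        have "cut k e u \<in> convex hull e'"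
          using cut_props(1)[OF cc' c'(5)] c(6) c'(6) that(1) by simp
        then have [simp]: "e' = e" using cut_props(3)[OF cc c(5) cc'] by simp
        have [simp]: "u' = u" using cut_props(4)[OF cc c(5), of u'] c c' that(1) by auto
        have "f' = f \<or> f' = g"
          using edge_in_two_polygons[of f g f' e] c c' p(1) p'(1) by auto
        moreover have "f' = f \<Longrightarrow> g' = g"
          using edge_in_two_polygons[of f g g' e] c c' p(1) p'(1) by auto
        moreover have "f' = g \<Longrightarrow> g' = f"
          using edge_in_two_polygons[of g f g' e] c c' p(1) p'(1) by auto
        ultimately have "E = E'" unfolding c(7) c'(7) by auto
        then show ?thesis using assms(3) by simp
      qed
    qed
  qed
  show ?thesis
  proof (cases "x \<in> skel")
    case True
    then have "x = z" "x = z'"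
      using spoke_end_inside[OF sp(1)] spoke_end_inside[OF sp'(1)] inside_not_skel[OF p(1)] inside_not_skel[OF p'(1)]
        assms sp sp' by auto
    show ?thesis
    proof (cases "f = f' \<longrightarrow> u = u'")
      case True
      then have eq: "f \<noteq> f'" "u = u'" "z = u" using same \<open>x = z\<close> \<open>x = z'\<close> by auto
      then have "z' = u" using \<open>x = z\<close> \<open>x = z'\<close> by simp
      have "u \<in> E \<inter> E'"
      proof -
        have "v \<in> F" if F: "spoke_end d v v F" for d v F
        proof -
          have "cut k e v \<noteq> v" if "e \<in> edges d" "v \<in> e" for e
            using cut_props(2)[of e v] edge_in_complex[of d e] spoke_end_props[OF F] that by auto
          then show ?thesis using F unfolding spoke_end_def by (metis insertI1 insertI2)
        qed
        then show ?thesis using sp(1) sp'(1) eq \<open>z' = u\<close> by blast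
      qed
      then show ?thesis using eq p(6) \<open>x = z\<close> by (metis image_eqI place_vert)
    next
      case False
      then show ?thesis
        using spoke_spoke[OF p(1,2,3), of u' z'] p' sp sp' assms by auto
    qed
  next
    case False
    then have "x \<in> I f" "x \<in> I f'"
      using spoke_end_inside[OF sp(1)] spoke_end_inside[OF sp'(1)] p(7) p'(7) assms sp sp' by auto
    then have [simp]: "f' = f" using insides_disjoint[OF p(1) p'(1)] by blast
    have "u' = u"
      using spoke_spoke[OF p(1,2,3), of u' z'] p'(2,3) sp(2) sp'(2) assms(4,5) by auto
    then have "z \<noteq> z'" using same by auto
    then have "x = Q f u"
      using spokes_at_vert[OF p(1,2,3), of z'] p'(3) sp(2) sp'(2) assms(4,5) \<open>u' = u\<close> by auto
    then have "x = place (copy f u)" using p(1,2) by simp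
    moreover have "copy f u \<in> E \<inter> E'" using p(4) p'(4) \<open>u' = u\<close> by simp
    ultimately show ?thesis by blast
  qed
qed

text \<open>A set of pieces and not a single one, since a graph edge across an edge between two
  polygons of the complex is drawn as two spokes.\<close>

definition pieces :: "complex set \<Rightarrow> complex set set" where
  "pieces E = {P. side_piece E P \<or> boundary_piece E P \<or> spoke_piece E P}"

lemma pieces_disjoint:
  assumes "P \<in> pieces E" "P' \<in> pieces E'" "E \<noteq> E'" "x \<in> P" "x \<in> P'"
  shows "x \<in> place ` (E \<inter> E')"
  using assms(1,2) unfolding pieces_def mem_Collect_eq
proof (elim disjE)
  assume "side_piece E P" "side_piece E' P'"
  then show ?thesis
    by (rule side_side[OF _ _ assms(3-5)])
next
  assume "side_piece E P" "boundary_piece E' P'"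
  then show ?thesis
    using side_boundary[OF _ _ assms(4,5)] by blast
next
  assume "side_piece E P" "spoke_piece E' P'"
  then show ?thesis
    by (rule side_spoke[OF _ _ assms(4,5)])
next
  assume "boundary_piece E P" "side_piece E' P'"
  then show ?thesis
    using side_boundary[OF _ _ assms(5,4)] by blast
next
  assume "boundary_piece E P" "boundary_piece E' P'"
  then show ?thesis
    by (rule boundary_boundary[OF _ _ assms(3-5)])
next
  assume "boundary_piece E P" "spoke_piece E' P'"
  then show ?thesis
    by (rule boundary_spoke[OF _ _ assms(4,5)])
next
  assume "spoke_piece E P" "side_piece E' P'"
  then show ?thesis
    using side_spoke[OF _ _ assms(5,4)] by (metis Int_commute)
next
  assume "spoke_piece E P" "boundary_piece E' P'"
  then show ?thesis
    using boundary_spoke[OF _ _ assms(5,4)] by (metis Int_commute)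
next
  assume "spoke_piece E P" "spoke_piece E' P'"
  then show ?thesis
    by (rule spoke_spoke_piece[OF _ _ assms(3-5)])
qed

text \<open>A drawn copy is an end of some side of its wavefront, so \<open>pieces_disjoint\<close>
  can be applied to that side. For a vertex of the complex the kinds of pieces are inspected one by
  one.\<close>

lemma pieces_avoid_verts:
  assumes "P \<in> pieces E" "x \<in> P" "x \<in> place ` new_verts"
  shows "x \<in> place ` E"
proof -
  from assms(3) consider (Q) f u where "f \<in> K" "u \<in> verts f" "x = Q f u" | (v) "x \<in> complex_verts K"
    by (auto simp: new_verts_def)
  then show ?thesis
  proof cases
    case (Q f u)
    obtain e where e: "e \<in> edges f" "u \<in> e"
      using offset_polygon.vert_in_edge[OF poly[OF Q(1)] Q(2)] by metis
    then have "side_piece (copy f ` e) (convex hull (Q f ` e))" "x \<in> convex hull (Q f ` e)"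
      using Q by (auto simp: side_piece_def intro: hull_inc)
    moreover have "x \<in> place ` copy f ` e"
      using Q e by (metis image_eqI place_copy)
    ultimately show ?thesis
      using pieces_disjoint[of P E "convex hull (Q f ` e)" "copy f ` e" x] assms(1,2)
      by (cases "E = copy f ` e") (auto simp: pieces_def)
  next
    case v
    then have x: "x \<in> skel" using vert_in_skel by simp
    from assms(1) consider "side_piece E P" | "boundary_piece E P" | "spoke_piece E P"
      by (auto simp: pieces_def)
    then show ?thesis
    proof cases
      case 1
      then show ?thesis
        using side_inside inside_not_skel x assms(2) unfolding side_piece_def by blast
    next
      case 2
      then have E: "E \<in> complex_edges K" "P = convex hull E"
        using edge_in_complex unfolding boundary_piece_def by auto
      then have "x \<in> E" using complex_vert_in_hull[OF v] assms(2) by simp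
      then show ?thesis using v by (metis image_eqI place_vert)
    next
      case 3
      then obtain f u z where sp: "spoke_end f u z E" "P = spoke f u z"
        unfolding spoke_piece_def by metis
      note p = spoke_end_props[OF sp(1)]
      have [simp]: "x = z"
        using spoke_end_inside[OF sp(1)] inside_not_skel[OF p(1)] assms sp x by auto
      have "cut k e u \<noteq> x" if "e \<in> edges f" "u \<in> e" for e
        using cut_props(2)[of e u] edge_in_complex[OF p(1)] that v by auto
      then have "z = u" "E = {copy f u, u}" using sp(1) unfolding spoke_end_def by auto
      then show ?thesis using p(6) by (metis \<open>x = z\<close> image_eqI insertI1 insertI2 place_vert)
    qed
  qed
qed

section \<open>Arcs for the graph edges\<close>

definition drawn :: "complex set \<Rightarrow> (real \<Rightarrow> complex) \<Rightarrow> bool" where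
  "drawn E \<gamma> \<longleftrightarrow> E \<subseteq> new_verts \<and> arc \<gamma> \<and> {pathstart \<gamma>, pathfinish \<gamma>} = place ` E \<and> path_image \<gamma> \<subseteq> \<Union>(pieces E)"

text \<open>Arcs can be chosen edge by edge: that they do not cross and avoid foreign vertices is
  already known for the pieces containing them.\<close>

lemma planar_drawing:
  assumes V: "V \<subseteq> new_verts" and E: "\<And>e. e \<in> E \<Longrightarrow> e \<subseteq> V \<and> (\<exists>\<gamma>. drawn e \<gamma>)"
  shows "planar_graph V E"
proof -
  obtain \<gamma> where d: "\<And>e. e \<in> E \<Longrightarrow> drawn e (\<gamma> e)" using E by metis
  have "path_image (\<gamma> e) \<inter> place ` V = place ` e" if "e \<in> E" for e
  proof
    show "path_image (\<gamma> e) \<inter> place ` V \<subseteq> place ` e"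
      using d[OF that] V pieces_avoid_verts unfolding drawn_def by blast
    have "place ` e \<subseteq> path_image (\<gamma> e)"
      using d[OF that] unfolding drawn_def by (metis empty_subsetI insert_subset pathfinish_in_path_image pathstart_in_path_image)
    then show "place ` e \<subseteq> path_image (\<gamma> e) \<inter> place ` V" using E[OF that] by blast
  qed
  moreover have "path_image (\<gamma> e) \<inter> path_image (\<gamma> e') \<subseteq> place ` (e \<inter> e')" if "e \<in> E" "e' \<in> E" "e \<noteq> e'" for e e'
    using d[OF that(1)] d[OF that(2)] pieces_disjoint[OF _ _ that(3)] unfolding drawn_def by blast
  moreover have "inj_on place V" using place_inj V by (rule inj_on_subset)
  ultimately show ?thesis
    unfolding planar_graph_def using E d[unfolded drawn_def]
    by (intro exI[of _ place] exI[of _ \<gamma>]) auto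
qed

lemma drawn_side:
  assumes "f \<in> K" "e \<in> edges f" shows "\<exists>\<gamma>. drawn (copy f ` e) \<gamma>"
proof -
  obtain u v where e: "e = {u, v}" "u \<noteq> v" "u \<in> verts f" "v \<in> verts f"
    using edge_doubleton[OF assms] by blast
  have "Q f u \<noteq> Q f v" using Q_inj[OF assms(1) assms(1) e(3,4)] e(2) by blast
  moreover have "side_piece (copy f ` e) (closed_segment (Q f u) (Q f v))"
    using assms e(1) unfolding side_piece_def segment_convex_hull by (intro exI[of _ f] exI[of _ e]) auto
  moreover have "copy f ` e \<subseteq> new_verts" using e assms(1) by (auto simp: new_verts_def)
  ultimately show ?thesis
    using e assms(1) unfolding drawn_def
    by (intro exI[of _ "linepath (Q f u) (Q f v)"]) (auto simp: pieces_def)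
qed

lemma drawn_boundary:
  assumes "f \<in> K" "e \<in> edges f" "h \<in> B" "e \<in> edges h" shows "\<exists>\<gamma>. drawn e \<gamma>"
proof -
  obtain u v where e: "e = {u, v}" "u \<noteq> v" "u \<in> verts f" "v \<in> verts f"
    using edge_doubleton[OF assms(1,2)] by blast
  then have c: "u \<in> complex_verts K" "v \<in> complex_verts K" using assms by (auto simp: complex_verts_def)
  have "boundary_piece e (closed_segment u v)"
    using assms e(1) unfolding boundary_piece_def segment_convex_hull by blast
  then show ?thesis
    using e c unfolding drawn_def
    by (intro exI[of _ "linepath u v"]) (auto simp: pieces_def new_verts_def)
qed

lemma drawn_spoke_boundary:
  assumes "f \<in> K" "u \<in> verts f" shows "\<exists>\<gamma>. drawn {copy f u, u} \<gamma>"
proof -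
  have u: "u \<in> complex_verts K" using assms by (auto simp: complex_verts_def)
  then have "Q f u \<noteq> u" using Q_inside[OF assms] inside_not_skel[OF assms(1)] vert_in_skel by metis
  moreover have "spoke_piece {copy f u, u} (spoke f u u)"
    using assms unfolding spoke_piece_def spoke_end_def by blast
  ultimately show ?thesis
    using u assms unfolding drawn_def
    by (intro exI[of _ "linepath (Q f u) u"]) (auto simp: pieces_def new_verts_def)
qed

text \<open>Apart from the common cut point, the two spokes lie in disjoint insides, so joining them
  gives an arc.\<close>

lemma drawn_spoke_interior:
  assumes "f \<in> K" "g \<in> K" "f \<noteq> g" "e \<in> edges f" "e \<in> edges g" "u \<in> e"
  shows "\<exists>\<gamma>. drawn {copy f u, copy g u} \<gamma>"
proof -
  let ?c = "cut k e u" and ?E = "{copy f u, copy g u}"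
  have uf: "u \<in> verts f" and ug: "u \<in> verts g"
    using edge_subset_verts assms by blast+
  have sf: "spoke_end f u ?c ?E" and "spoke_end g u ?c {copy g u, copy f u}"
    unfolding spoke_end_def using assms uf ug by blast+
  then have sg: "spoke_end g u ?c ?E"
    by (simp only: insert_commute[of "copy g u"])
  have "Q f u \<noteq> ?c" "Q g u \<noteq> ?c"
    using Q_inside[OF assms(1) uf] Q_inside[OF assms(2) ug] inside_not_skel[OF assms(1)] inside_not_skel[OF assms(2)]
      spoke_end_props(7)[OF sf] by auto
  moreover have "spoke f u ?c \<inter> spoke g u ?c \<subseteq> {?c}"
    using spoke_end_inside[OF sf] spoke_end_inside[OF sg] insides_disjoint[OF assms(1,2)] assms(3) by blast
  ultimately have "arc (linepath (Q f u) ?c +++ linepath ?c (Q g u))"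
    by (intro arc_join) (auto simp: closed_segment_commute)
  moreover have "path_image (linepath (Q f u) ?c +++ linepath ?c (Q g u)) = spoke f u ?c \<union> spoke g u ?c"
    by (simp add: path_image_join closed_segment_commute)
  moreover have "spoke f u ?c \<in> pieces ?E" "spoke g u ?c \<in> pieces ?E"
    using sf sg by (auto simp: pieces_def spoke_piece_def)
  moreover have "?E \<subseteq> new_verts" "place ` ?E = {Q f u, Q g u}"
    using assms uf ug by (auto simp: new_verts_def)
  ultimately show ?thesis
    unfolding drawn_def
    by (intro exI[of _ "linepath (Q f u) ?c +++ linepath ?c (Q g u)"]) auto
qed

section \<open>Cells of the Euler transformation\<close>

lemma vcopy_outside: "f \<notin> K \<Longrightarrow> copy f u = u"
  by (simp add: vcopy_def)

text \<open>Rules out vertex cell edges between two polygons of \<open>B\<close>, whose copies of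
  the vertex would coincide. Regions are closed and so contain their corners, and at least one of
  two different polygons of \<open>B\<close> is a hole, hence disjoint from the other.\<close>

lemma holes_share_no_vert:
  assumes "g \<in> B" "h \<in> B" "g \<noteq> h" shows "verts g \<inter> verts h = {}"
proof -
  have "\<forall>g\<in>B. \<forall>h\<in>H. g \<noteq> h \<longrightarrow> region g \<inter> region h = {}"
    using holes unfolding holes_and_outside_def by (elim conjE)
  moreover have "g \<in> H \<or> h \<in> H" using assms by auto
  ultimately have "region g \<inter> region h = {}"
    using assms by (metis Int_commute)
  moreover have "verts f \<subseteq> region f" if "f \<in> B" for f
  proof -
    have "polygonal_face f"
      using holes that by (auto simp: holes_and_outside_def hole_polygon_def outside_polygon_def)
    then have f: "frontier (region f) = bd f" "closure (interior (region f)) = region f"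
      by (auto simp: polygonal_face_def)
    then have "bd f \<subseteq> region f"
      using frontier_subset_closed[of "region f"] closed_closure[of "interior (region f)"] by simp
    then show ?thesis using vert_in_bd by blast
  qed
  ultimately show ?thesis using assms by blast
qed

lemma skeleton_verts_subset: "skeleton_verts (euler_transformation K H Out t) \<subseteq> new_verts"
proof -
  have copyK: "copy f u \<in> new_verts" if "f \<in> K" "u \<in> verts f" for f u
    unfolding new_verts_def using that by blast
  have copy: "copy f u \<in> new_verts" if "f \<in> K \<longrightarrow> u \<in> verts f" "u \<in> complex_verts K" for f u
    using that copyK by (cases "f \<in> K") (auto simp: new_verts_def vcopy_outside)
  have "fst c \<subseteq> new_verts" if "c \<in> class1 K t" for c
    using that copyK by (auto simp: class1_def)
  moreover have "fst c \<subseteq> new_verts" if c: "c \<in> class2 K H Out t" for c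
  proof -
    obtain f f' u v where *: "c = edge_cell K t f f' u v" "f \<in> K" "{u, v} \<in> edges f" "{u, v} \<in> edges f'"
      using c by (auto simp: class2_def)
    have "u \<in> verts f" "v \<in> verts f" "f' \<in> K \<longrightarrow> u \<in> verts f'" "f' \<in> K \<longrightarrow> v \<in> verts f'"
      using edge_subset_verts[of f "{u, v}"] edge_subset_verts[of f' "{u, v}"] * by auto
    moreover from this(1,2) have "u \<in> complex_verts K" "v \<in> complex_verts K"
      using *(2) by (auto simp: complex_verts_def)
    ultimately show ?thesis using *(1) copy by (simp add: edge_cell_def Let_def)
  qed
  moreover have "fst c \<subseteq> new_verts" if "c \<in> class3 K H Out t" for c
    using that copy by (auto simp: class3_def vertex_cell_def Let_def)
  ultimately show ?thesis
    unfolding skeleton_verts_def euler_transformation_def by blast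
qed

lemma skeleton_edges_subset: "E \<in> skeleton_edges C \<Longrightarrow> (\<And>c. c \<in> C \<Longrightarrow> \<Union>(snd c) \<subseteq> fst c) \<Longrightarrow> E \<subseteq> skeleton_verts C"
  unfolding skeleton_edges_def skeleton_verts_def by blast

lemma cell_edges_subset:
  assumes "c \<in> euler_transformation K H Out t" shows "\<Union>(snd c) \<subseteq> fst c"
proof -
  have "copy f ` e \<subseteq> copy f ` verts f" if "f \<in> K" "e \<in> edges f" for f e
    using edge_subset_verts[OF that] by (rule image_mono)
  then show ?thesis
    using assms unfolding euler_transformation_def
    by (elim UnE) (fastforce simp: class1_def, auto simp: class2_def class3_def edge_cell_def vertex_cell_def Let_def)
qed

lemma drawn_spoke:
  assumes "f \<in> K" "g \<in> K \<union> B" "f \<noteq> g" "e \<in> edges f" "e \<in> edges g" "u \<in> e"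
  shows "\<exists>\<gamma>. drawn {copy f u, copy g u} \<gamma>"
proof (cases "g \<in> K")
  case True
  then show ?thesis using drawn_spoke_interior assms by blast
next
  case False
  have "u \<in> verts f" using edge_subset_verts[OF assms(1,4)] assms(6) by blast
  then show ?thesis using drawn_spoke_boundary[OF assms(1)] vcopy_outside[OF False] by simp
qed

lemma skeleton_edge_drawn:
  assumes "E \<in> skeleton_edges (euler_transformation K H Out t)"
  shows "\<exists>\<gamma>. drawn E \<gamma>"
proof -
  obtain c where c: "E \<in> snd c" "c \<in> class1 K t \<or> c \<in> class2 K H Out t \<or> c \<in> class3 K H Out t"
    using assms by (auto simp: skeleton_edges_def euler_transformation_def)
  from c(2) show ?thesis
  proof (elim disjE)
    assume "c \<in> class1 K t"
    then show ?thesis using c(1) drawn_side by (auto simp: class1_def)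
  next
    assume "c \<in> class2 K H Out t"
    then obtain f f' u v where *: "c = edge_cell K t f f' u v" "f \<in> K" "f' \<in> K \<union> B" "f \<noteq> f'"
        "{u, v} \<in> edges f" "{u, v} \<in> edges f'"
      by (auto simp: class2_def)
    from c(1) consider "E = copy f ` {u, v}" | "E = copy f' ` {u, v}"
      | "E = {copy f u, copy f' u}" | "E = {copy f v, copy f' v}"
      by (auto simp: *(1) edge_cell_def Let_def)
    then show ?thesis
    proof cases
      case 1
      then show ?thesis using drawn_side[OF *(2,5)] by simp
    next
      \<comment> \<open>The far side of the 4-gon is a side of the wavefront of \<open>f'\<close>,
        or the boundary edge itself if \<open>f'\<close> is a hole or the outside.\<close>
      case 2
      show ?thesis
      proof (cases "f' \<in> K")
        case True
        then show ?thesis using 2 drawn_side[OF True *(6)] by simp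
      next
        case False
        then have "E = {u, v}" "f' \<in> B" using 2 *(3) by (auto simp: vcopy_outside)
        then show ?thesis using drawn_boundary[OF *(2,5)] *(6) by blast
      qed
    qed (use drawn_spoke[OF *(2-6)] in auto)
  next
    assume "c \<in> class3 K H Out t"
    then obtain v where "c = vertex_cell K H Out t v" by (auto simp: class3_def)
    then obtain f g e where *: "f \<in> K \<union> B" "g \<in> K \<union> B" "v \<in> verts f" "v \<in> verts g" "f \<noteq> g"
        "v \<in> e" "e \<in> edges f" "e \<in> edges g" "E = {copy f v, copy g v}"
      using c(1) by (auto simp: vertex_cell_def Let_def)
    \<comment> \<open>The pair is unordered, so the polygon in \<open>K\<close> can take the first
      place in \<open>drawn_spoke\<close>.\<close>
    then have "f \<in> K \<or> g \<in> K"
      using holes_share_no_vert[of f g] by blast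
    then show ?thesis
    proof
      assume "f \<in> K"
      then show ?thesis using drawn_spoke[of f g e v] * by simp
    next
      assume "g \<in> K"
      then show ?thesis using drawn_spoke[of g f e v] * by (simp add: insert_commute)
    qed
  qed
qed

lemma planar: "planar_graph (skeleton_verts (euler_transformation K H Out t))
    (skeleton_edges (euler_transformation K H Out t))"
  using skeleton_verts_subset skeleton_edges_subset cell_edges_subset skeleton_edge_drawn
  by (intro planar_drawing) auto

end

theorem lemma3p5:
  fixes K H :: "polygon set" and Out :: polygon and t :: "polygon \<Rightarrow> real"
  assumes "finite K"
    and "connected (underlying_space K)"
    and "polygonal_complex K"
    and "holes_and_outside K H Out"
    and "\<And>f. f \<in> K \<Longrightarrow> admissible_offset f (t f)"
  shows "planar_graph (skeleton_verts (euler_transformation K H Out t))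
                      (skeleton_edges (euler_transformation K H Out t))"
proof -
  interpret complex_with_holes K H Out t
    using assms by unfold_locales
  obtain s k where "drawing K H Out t s k"
    using drawing_scale complex_with_holes_axioms unfolding drawing_def drawing_axioms_def by metis
  then show ?thesis by (rule drawing.planar)
qed

end
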